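(* Let $R$ be an integral domain and let $\{X_\alpha\}$ be a set of independent indeterminates over $R$. If $R$ is a $t\#$-domain, then so is $R[\{X_\alpha\}]$.
   Context: For a nonzero fractional ideal $I$ of a domain $D$ with quotient field $F$: $I^{-1} = \{x \in F \mid xI \subseteq D\}$, $I_v = (I^{-1})^{-1}$, and $I_t = \bigcup J_v$, the union over all nonzero finitely generated $J \subseteq I$; $I$ is a $t$-ideal if $I = I_t$. A maximal $t$-ideal is an ideal maximal among the proper nonzero integral $t$-ideals; $t\text{-Max}(D)$ is the set of these. $D$ is a $t\#$-domain if $\bigcap_{M \in \mathcal M_1} D_M \neq \bigcap_{M \in \mathcal M_2} D_M$ for any two distinct subsets $\mathcal M_1, \mathcal M_2$ of $t\text{-Max}(D)$ (an empty intersection being $F$). *)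

theory Defs
  imports
    "HOL-Library.Poly_Mapping"
    "HOL-Computational_Algebra.Polynomial_Factorial"
begin

text \<open>
  \<open>('x \<Rightarrow>\<^sub>0 nat) \<Rightarrow>\<^sub>0 'a\<close> is the polynomial ring over \<open>'a\<close> with one indeterminate for each element
  of \<open>'x\<close>, but the library shows it to be an integral domain only if \<open>'x\<close> is linearly ordered.
  The copy below is an integral domain for every type \<open>'x\<close>.
\<close>

typedef (overloaded) ('x, 'a) mpoly =
  "UNIV :: (('x \<Rightarrow>\<^sub>0 nat) \<Rightarrow>\<^sub>0 'a::zero) set"
  morphisms mapping_of MPoly
  by simp

setup_lifting type_definition_mpoly

instantiation mpoly :: (type, comm_ring_1) comm_ring_1
begin

lift_definition zero_mpoly :: "('a, 'b) mpoly"
  is "0 :: ('a \<Rightarrow>\<^sub>0 nat) \<Rightarrow>\<^sub>0 'b" .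
lift_definition one_mpoly :: "('a, 'b) mpoly"
  is "1 :: ('a \<Rightarrow>\<^sub>0 nat) \<Rightarrow>\<^sub>0 'b" .
lift_definition plus_mpoly :: "('a, 'b) mpoly \<Rightarrow> ('a, 'b) mpoly \<Rightarrow> ('a, 'b) mpoly"
  is "(+) :: (('a \<Rightarrow>\<^sub>0 nat) \<Rightarrow>\<^sub>0 'b) \<Rightarrow> _" .
lift_definition minus_mpoly :: "('a, 'b) mpoly \<Rightarrow> ('a, 'b) mpoly \<Rightarrow> ('a, 'b) mpoly"
  is "(-) :: (('a \<Rightarrow>\<^sub>0 nat) \<Rightarrow>\<^sub>0 'b) \<Rightarrow> _" .
lift_definition uminus_mpoly :: "('a, 'b) mpoly \<Rightarrow> ('a, 'b) mpoly"
  is "uminus :: (('a \<Rightarrow>\<^sub>0 nat) \<Rightarrow>\<^sub>0 'b) \<Rightarrow> _" .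
lift_definition times_mpoly :: "('a, 'b) mpoly \<Rightarrow> ('a, 'b) mpoly \<Rightarrow> ('a, 'b) mpoly"
  is "(*) :: (('a \<Rightarrow>\<^sub>0 nat) \<Rightarrow>\<^sub>0 'b) \<Rightarrow> _" .

instance
  by intro_classes (transfer, simp add: algebra_simps)+

end

lemma ex_unique_sum_of_monomials:
  fixes M N :: "('x \<Rightarrow>\<^sub>0 nat) set"
  assumes "finite V" "finite M" "finite N" "M \<noteq> {}" "N \<noteq> {}"
    and "\<And>m m' x. m \<in> M \<Longrightarrow> m' \<in> M \<Longrightarrow> x \<notin> V \<Longrightarrow>
           Poly_Mapping.lookup m x = Poly_Mapping.lookup m' x"
    and "\<And>n n' x. n \<in> N \<Longrightarrow> n' \<in> N \<Longrightarrow> x \<notin> V \<Longrightarrow>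
           Poly_Mapping.lookup n x = Poly_Mapping.lookup n' x"
  shows "\<exists>m\<in>M. \<exists>n\<in>N. \<forall>m'\<in>M. \<forall>n'\<in>N. m' + n' = m + n \<longrightarrow> m' = m \<and> n' = n"
  using assms
proof (induction V arbitrary: M N rule: finite_induct)
  case empty
  obtain m n where mn: "m \<in> M" "n \<in> N"
    using empty.prems by blast
  have "m' = m \<and> n' = n" if "m' \<in> M" "n' \<in> N" for m' n'
    using empty.prems(5)[OF that(1) mn(1)] empty.prems(6)[OF that(2) mn(2)]
    by (simp add: poly_mapping_eqI)
  then show ?case
    using mn by blast
next
  case (insert x V)
  define a where "a = Max ((\<lambda>m. Poly_Mapping.lookup m x) ` M)"
  define b where "b = Max ((\<lambda>n. Poly_Mapping.lookup n x) ` N)"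
  define M' where "M' = {m \<in> M. Poly_Mapping.lookup m x = a}"
  define N' where "N' = {n \<in> N. Poly_Mapping.lookup n x = b}"
  have le: "\<And>m. m \<in> M \<Longrightarrow> Poly_Mapping.lookup m x \<le> a" "\<And>n. n \<in> N \<Longrightarrow> Poly_Mapping.lookup n x \<le> b"
    using insert.prems by (auto simp: a_def b_def)
  have "a \<in> (\<lambda>m. Poly_Mapping.lookup m x) ` M" "b \<in> (\<lambda>n. Poly_Mapping.lookup n x) ` N"
    using insert.prems by (auto simp: a_def b_def intro!: Max_in)
  then have ne: "M' \<noteq> {}" "N' \<noteq> {}"
    by (auto simp: M'_def N'_def)
  have "\<exists>m\<in>M'. \<exists>n\<in>N'. \<forall>m'\<in>M'. \<forall>n'\<in>N'. m' + n' = m + n \<longrightarrow> m' = m \<and> n' = n"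
  proof (rule insert.IH)
    show "Poly_Mapping.lookup m y = Poly_Mapping.lookup m' y" if "m \<in> M'" "m' \<in> M'" "y \<notin> V" for m m' y
      using that insert.prems(5)[of m m' y] by (cases "y = x") (auto simp: M'_def)
    show "Poly_Mapping.lookup n y = Poly_Mapping.lookup n' y" if "n \<in> N'" "n' \<in> N'" "y \<notin> V" for n n' y
      using that insert.prems(6)[of n n' y] by (cases "y = x") (auto simp: N'_def)
  qed (use ne insert.prems in \<open>auto simp: M'_def N'_def\<close>)
  then obtain m n where mn: "m \<in> M'" "n \<in> N'"
    and uniq: "\<And>m' n'. m' \<in> M' \<Longrightarrow> n' \<in> N' \<Longrightarrow> m' + n' = m + n \<Longrightarrow> m' = m \<and> n' = n"
    by blast
  have "m' = m \<and> n' = n" if "m' \<in> M" "n' \<in> N" "m' + n' = m + n" for m' n'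
  proof -
    have "Poly_Mapping.lookup m' x + Poly_Mapping.lookup n' x = a + b"
      using arg_cong[OF that(3), of "\<lambda>k. Poly_Mapping.lookup k x"] mn
      by (simp add: lookup_add M'_def N'_def)
    then have "m' \<in> M'" "n' \<in> N'"
      using le(1)[OF that(1)] le(2)[OF that(2)] that by (auto simp: M'_def N'_def)
    then show ?thesis
      using uniq that(3) by blast
  qed
  then show ?case
    using mn by (auto simp: M'_def N'_def)
qed

lemma poly_mapping_mult_neq_0:
  fixes p q :: "('x \<Rightarrow>\<^sub>0 nat) \<Rightarrow>\<^sub>0 'a::idom"
  assumes "p \<noteq> 0" "q \<noteq> 0"
  shows "p * q \<noteq> 0"
proof -
  define V where "V = (\<Union>m\<in>Poly_Mapping.keys p \<union> Poly_Mapping.keys q. Poly_Mapping.keys m)"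
  have V: "Poly_Mapping.lookup m x = 0" if "m \<in> Poly_Mapping.keys p \<union> Poly_Mapping.keys q" "x \<notin> V" for m x
    using that by (auto simp: V_def in_keys_iff)
  have "\<exists>m\<in>Poly_Mapping.keys p. \<exists>n\<in>Poly_Mapping.keys q.
      \<forall>m'\<in>Poly_Mapping.keys p. \<forall>n'\<in>Poly_Mapping.keys q.
        m' + n' = m + n \<longrightarrow> m' = m \<and> n' = n"
    by (rule ex_unique_sum_of_monomials[of V]) (use assms V in \<open>auto simp: V_def\<close>)
  then obtain m n where mn: "m \<in> Poly_Mapping.keys p" "n \<in> Poly_Mapping.keys q"
    and uniq: "\<And>m' n'. m' \<in> Poly_Mapping.keys p \<Longrightarrow> n' \<in> Poly_Mapping.keys q \<Longrightarrow>
      m' + n' = m + n \<Longrightarrow> m' = m \<and> n' = n"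
    by blast
  have "Poly_Mapping.lookup (p * q) (m + n) =
      (\<Sum>(a, b). Poly_Mapping.lookup p a * Poly_Mapping.lookup q b when m + n = a + b)"
    by (simp add: times_poly_mapping.rep_eq prod_fun_unfold_prod)
  also have "\<dots> = (\<Sum>ab. (Poly_Mapping.lookup p m * Poly_Mapping.lookup q n when ab = (m, n)))"
  proof (rule Sum_any.cong)
    fix ab :: "('x \<Rightarrow>\<^sub>0 nat) \<times> ('x \<Rightarrow>\<^sub>0 nat)"
    obtain a b where ab: "ab = (a, b)"
      by (cases ab)
    show "(case ab of (a, b) \<Rightarrow> Poly_Mapping.lookup p a * Poly_Mapping.lookup q b when m + n = a + b) =
        (Poly_Mapping.lookup p m * Poly_Mapping.lookup q n when ab = (m, n))"
    proof (cases "a \<in> Poly_Mapping.keys p \<and> b \<in> Poly_Mapping.keys q")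
      case True
      then show ?thesis
        using uniq[of a b] by (auto simp: ab when_def)
    next
      case False
      then have "Poly_Mapping.lookup p a * Poly_Mapping.lookup q b = 0"
        by (auto simp: in_keys_iff)
      then show ?thesis
        using False mn by (auto simp: ab when_def)
    qed
  qed
  also have "\<dots> = Poly_Mapping.lookup p m * Poly_Mapping.lookup q n"
    by simp
  also have "\<dots> \<noteq> 0"
    using mn by (simp add: in_keys_iff)
  finally show ?thesis
    by auto
qed

instance mpoly :: (type, idom) idom
proof
  fix p q :: "('a, 'b) mpoly"
  assume "p \<noteq> 0" "q \<noteq> 0"
  then have "mapping_of p * mapping_of q \<noteq> 0"
    by (intro poly_mapping_mult_neq_0) (metis mapping_of_inject zero_mpoly.rep_eq)+
  then show "p * q \<noteq> 0"
    by (metis times_mpoly.rep_eq zero_mpoly.rep_eq)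
qed

text \<open>\<open>R[{X\<^sub>\<alpha>}\<^bsub>\<alpha> \<in> A\<^esub>]\<close>: all coefficients lie in \<open>R\<close>, and only indeterminates
  indexed by \<open>A\<close> occur.\<close>

definition poly_ring :: "'a::zero set \<Rightarrow> 'x set \<Rightarrow> ('x, 'a) mpoly set" where
  "poly_ring R A = {p. range (Poly_Mapping.lookup (mapping_of p)) \<subseteq> R \<and>
                       (\<forall>m\<in>Poly_Mapping.keys (mapping_of p). Poly_Mapping.keys m \<subseteq> A)}"

text \<open>An integral domain is given as a subring (with 1) of a type of class \<^class>\<open>idom\<close>.\<close>

definition subdomain :: "'a::idom set \<Rightarrow> bool" where
  "subdomain D \<longleftrightarrow> 1 \<in> D \<and> (\<forall>x\<in>D. \<forall>y\<in>D. x - y \<in> D \<and> x * y \<in> D)"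

text \<open>Up to \<open>t_sharp_in_field\<close>, \<open>D\<close> is a subring of some ambient field, and its quotient field is
  formed inside that field.\<close>

definition quotient_field :: "'k::field set \<Rightarrow> 'k set" where
  "quotient_field D = {a / b | a b. a \<in> D \<and> b \<in> D \<and> b \<noteq> 0}"

definition submodule_of_qf :: "'k::field set \<Rightarrow> 'k set \<Rightarrow> bool" where
  "submodule_of_qf D I \<longleftrightarrow> I \<subseteq> quotient_field D \<and> 0 \<in> I \<and>
     (\<forall>x\<in>I. \<forall>y\<in>I. x + y \<in> I) \<and> (\<forall>r\<in>D. \<forall>x\<in>I. r * x \<in> I)"

definition nonzero_fractional_ideal :: "'k::field set \<Rightarrow> 'k set \<Rightarrow> bool" where
  "nonzero_fractional_ideal D I \<longleftrightarrow> submodule_of_qf D I \<and> I \<noteq> {0} \<and>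
     (\<exists>d\<in>D. d \<noteq> 0 \<and> (\<forall>x\<in>I. d * x \<in> D))"

definition ideal_inverse :: "'k::field set \<Rightarrow> 'k set \<Rightarrow> 'k set" where
  "ideal_inverse D I = {x \<in> quotient_field D. \<forall>y\<in>I. x * y \<in> D}"

definition v_closure :: "'k::field set \<Rightarrow> 'k set \<Rightarrow> 'k set" where
  "v_closure D I = ideal_inverse D (ideal_inverse D I)"

definition finitely_generated_ideal :: "'k::field set \<Rightarrow> 'k set \<Rightarrow> bool" where
  "finitely_generated_ideal D J \<longleftrightarrow>
     (\<exists>B. finite B \<and> B \<subseteq> quotient_field D \<and>
          J = {\<Sum>b\<in>B. c b * b | c. \<forall>b\<in>B. c b \<in> D})"

definition t_closure :: "'k::field set \<Rightarrow> 'k set \<Rightarrow> 'k set" where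
  "t_closure D I =
     \<Union> {v_closure D J | J. J \<subseteq> I \<and> J \<noteq> {0} \<and> finitely_generated_ideal D J}"

definition t_ideal :: "'k::field set \<Rightarrow> 'k set \<Rightarrow> bool" where
  "t_ideal D I \<longleftrightarrow> nonzero_fractional_ideal D I \<and> t_closure D I = I"

definition t_Max :: "'k::field set \<Rightarrow> 'k set set" where
  "t_Max D = {M. t_ideal D M \<and> M \<subset> D \<and>
                 (\<forall>N. t_ideal D N \<and> N \<subset> D \<and> M \<subseteq> N \<longrightarrow> N = M)}"

definition localization_at :: "'k::field set \<Rightarrow> 'k set \<Rightarrow> 'k set" where
  "localization_at D M = {a / s | a s. a \<in> D \<and> s \<in> D \<and> s \<notin> M}"

text \<open>Intersecting with the quotient field only matters for the empty family: every localization
  is contained in it.\<close>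

definition inter_localizations :: "'k::field set \<Rightarrow> 'k set set \<Rightarrow> 'k set" where
  "inter_localizations D MM = quotient_field D \<inter> (\<Inter>M\<in>MM. localization_at D M)"

definition t_sharp_in_field :: "'k::field set \<Rightarrow> bool" where
  "t_sharp_in_field D \<longleftrightarrow>
     (\<forall>M1 M2. M1 \<subseteq> t_Max D \<and> M2 \<subseteq> t_Max D \<and> M1 \<noteq> M2 \<longrightarrow>
        inter_localizations D M1 \<noteq> inter_localizations D M2)"

definition t_sharp_domain :: "'a::idom set \<Rightarrow> bool" where
  "t_sharp_domain D \<longleftrightarrow> subdomain D \<and> t_sharp_in_field (to_fract ` D)"

end

theory Submission
  imports Defs
begin

text \<open>A domain \<open>D\<close> is a \<open>t#\<close>-domain iff every maximal \<open>t\<close>-ideal \<open>M\<close> is \<^emph>\<open>isolated\<close>: some fraction \<open>a/b\<close>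
  lies in \<open>D\<^sub>N\<close> for all maximal \<open>t\<close>-ideals \<open>N \<noteq> M\<close> but not in \<open>D\<^sub>M\<close>. One compares the intersection over
  all maximal \<open>t\<close>-ideals with the one that omits \<open>M\<close>; conversely, a fraction isolating \<open>M\<close> separates any
  family containing \<open>M\<close> from any family avoiding it. Isolation can be expressed by divisibility in
  \<open>D\<close>, so that the quotient field disappears (\<open>t_sharp_domain_iff_isolated\<close>).

  Let \<open>D = R[X]\<close>, with \<open>X\<close> any family of indeterminates, and let \<open>Q\<close> be a maximal \<open>t\<close>-ideal of \<open>D\<close>.
  Write \<open>c(Q)\<close> for the ideal of \<open>R\<close> generated by all coefficients of elements of \<open>Q\<close>.

  Suppose \<open>Q\<close> contains some nonzero \<open>c \<in> R\<close>. If \<open>c(Q)\<^sub>t = R\<close>, there would be a finite \<open>G \<subseteq> Q\<close> whose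
  coefficients have \<open>v\<close>-hull \<open>R\<close>, and McCoy's theorem on zero divisors modulo \<open>cR\<close> (\<open>mccoy\<close>) would give
  \<open>1 \<in> (G \<union> {c})\<^sub>v \<subseteq> Q\<close>. So \<open>c(Q)\<^sub>t[X]\<close> is a proper \<open>t\<close>-ideal containing \<open>Q\<close>, whence \<open>Q = P[X]\<close> with
  \<open>P = Q \<inter> R\<close> a maximal \<open>t\<close>-ideal of \<open>R\<close> (\<open>t_maximal_extended\<close>). A fraction of \<open>R\<close> isolating \<open>P\<close> then
  isolates \<open>Q\<close>: it lies in \<open>D\<^sub>N\<close> whenever \<open>N \<inter> R = 0\<close>, and the other \<open>N\<close> are again extended from \<open>R\<close>.

  Suppose instead that \<open>Q \<inter> R = 0\<close> and there is only one indeterminate. Then \<open>c(Q)\<^sub>t = R\<close>, so a finite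
  \<open>G \<subseteq> Q\<close> lies in no extended maximal \<open>t\<close>-ideal. A nonzero polynomial lies in only finitely many maximal
  \<open>t\<close>-ideals that meet \<open>R\<close> in \<open>0\<close>, since these come from its irreducible factors over the quotient field
  (\<open>finite_uppers_to_zero\<close>). Adding to \<open>G\<close> one element of \<open>Q\<close> outside each of them other than \<open>Q\<close> gives
  a finite set contained in \<open>Q\<close> and in no other maximal \<open>t\<close>-ideal, and such a set isolates \<open>Q\<close>.

  The two cases prove the theorem for one indeterminate, hence for finitely many. For an arbitrary family
  and given \<open>Q\<close>, let \<open>F\<close> be the finite set of indeterminates of a nonzero element of \<open>Q\<close>. Then \<open>Q\<close>
  meets \<open>R[X\<^sub>F]\<close>, already known to be a \<open>t#\<close>-domain, in a nonzero ideal, and the first case applies to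
  \<open>R[X\<^sub>F] \<subseteq> R[X]\<close>.\<close>

section \<open>Ideals closed under the \<open>t\<close>-operation, without fractions\<close>

text \<open>For \<open>b \<noteq> 0\<close> this says that the fraction \<open>x / b\<close> lies in \<open>D\<close>.\<close>
definition divides_in :: "'a::idom set \<Rightarrow> 'a \<Rightarrow> 'a \<Rightarrow> bool" where
  "divides_in D b x \<longleftrightarrow> (\<exists>r\<in>D. x = b * r)"

text \<open>The ideal \<open>J\<^sub>v\<close>: the fraction \<open>a / b\<close> lies in \<open>J\<inverse>\<close> iff \<open>b\<close> divides \<open>a j\<close> in \<open>D\<close> for all \<open>j \<in> J\<close>.\<close>
definition v_hull :: "'a::idom set \<Rightarrow> 'a set \<Rightarrow> 'a set" where
  "v_hull D J = {x \<in> D. \<forall>a\<in>D. \<forall>b\<in>D - {0}.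
     (\<forall>j\<in>J. divides_in D b (a * j)) \<longrightarrow> divides_in D b (a * x)}"

text \<open>The \<open>t\<close>-ideals contained in \<open>D\<close>. Closure under the \<open>v\<close>-hulls of finite subsets already makes \<open>M\<close> an
  ideal, see \<open>t_closed_ideal\<close> below.\<close>
definition t_closed :: "'a::idom set \<Rightarrow> 'a set \<Rightarrow> bool" where
  "t_closed D M \<longleftrightarrow> M \<subseteq> D \<and> (\<exists>x\<in>M. x \<noteq> 0) \<and>
     (\<forall>J. finite J \<and> J \<subseteq> M \<and> (\<exists>j\<in>J. j \<noteq> 0) \<longrightarrow> v_hull D J \<subseteq> M)"

definition t_hull :: "'a::idom set \<Rightarrow> 'a set \<Rightarrow> 'a set" where
  "t_hull D S = \<Union> {v_hull D J | J. finite J \<and> J \<subseteq> S \<and> (\<exists>j\<in>J. j \<noteq> 0)}"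

definition t_maximal :: "'a::idom set \<Rightarrow> 'a set set" where
  "t_maximal D = {M. t_closed D M \<and> 1 \<notin> M \<and>
     (\<forall>N. t_closed D N \<and> 1 \<notin> N \<and> M \<subseteq> N \<longrightarrow> N = M)}"

text \<open>The fraction \<open>a / b\<close> lies in the localization of \<open>D\<close> at each maximal \<open>t\<close>-ideal except \<open>M\<close>.\<close>
definition isolated :: "'a::idom set \<Rightarrow> 'a set \<Rightarrow> bool" where
  "isolated D M \<longleftrightarrow> (\<exists>a\<in>D. \<exists>b\<in>D - {0}. (\<forall>s\<in>D - M. \<not> divides_in D b (a * s)) \<and>
     (\<forall>N\<in>t_maximal D - {M}. \<exists>s\<in>D - N. divides_in D b (a * s)))"

lemma subdomain_closed:
  assumes "subdomain D"
  shows "0 \<in> D" "1 \<in> D" "x \<in> D \<Longrightarrow> y \<in> D \<Longrightarrow> x - y \<in> D" "x \<in> D \<Longrightarrow> y \<in> D \<Longrightarrow> x * y \<in> D"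
    "x \<in> D \<Longrightarrow> - x \<in> D" "x \<in> D \<Longrightarrow> y \<in> D \<Longrightarrow> x + y \<in> D" "x \<in> D \<Longrightarrow> x ^ k \<in> D"
proof -
  show 1: "1 \<in> D" and d: "\<And>x y. x \<in> D \<Longrightarrow> y \<in> D \<Longrightarrow> x - y \<in> D"
    and m: "\<And>x y. x \<in> D \<Longrightarrow> y \<in> D \<Longrightarrow> x * y \<in> D"
    using assms by (auto simp: subdomain_def)
  show 0: "0 \<in> D" using d[OF 1 1] by simp
  show n: "\<And>x. x \<in> D \<Longrightarrow> - x \<in> D" using d[OF 0] by simp
  show "\<And>x y. x \<in> D \<Longrightarrow> y \<in> D \<Longrightarrow> x + y \<in> D" using d n by (metis diff_minus_eq_add)
  show "\<And>x. x \<in> D \<Longrightarrow> x ^ k \<in> D" by (induction k) (auto intro: 1 m)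
qed

lemma subdomain_sum:
  assumes "subdomain D" "\<And>i. i \<in> I \<Longrightarrow> f i \<in> D"
  shows "sum f I \<in> D"
  using assms(2)
  by (induction I rule: infinite_finite_induct) (auto intro: subdomain_closed[OF assms(1)])

lemma divides_in_add:
  assumes "subdomain D" "divides_in D b x" "divides_in D b y"
  shows "divides_in D b (x + y)"
proof -
  obtain r s where "r \<in> D" "s \<in> D" "x = b * r" "y = b * s"
    using assms(2,3) by (auto simp: divides_in_def)
  then show ?thesis
    using subdomain_closed(6)[OF assms(1), of r s]
    by (auto simp: divides_in_def distrib_left intro!: bexI[of _ "r + s"])
qed

lemma divides_in_mult:
  assumes "subdomain D" "divides_in D b x" "r \<in> D"
  shows "divides_in D b (r * x)"
proof -
  obtain s where "s \<in> D" "x = b * s"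
    using assms(2) by (auto simp: divides_in_def)
  then show ?thesis
    using subdomain_closed(4)[OF assms(1,3), of s]
    by (auto simp: divides_in_def intro!: bexI[of _ "r * s"])
qed

lemma v_hull_subset: "v_hull D J \<subseteq> D"
  by (auto simp: v_hull_def)

lemma v_hullI:
  assumes "x \<in> D"
    and "\<And>a b. a \<in> D \<Longrightarrow> b \<in> D \<Longrightarrow> b \<noteq> 0 \<Longrightarrow> (\<And>j. j \<in> J \<Longrightarrow> divides_in D b (a * j)) \<Longrightarrow>
           divides_in D b (a * x)"
  shows "x \<in> v_hull D J"
  using assms by (auto simp: v_hull_def)

lemma v_hullD:
  assumes "x \<in> v_hull D J" "a \<in> D" "b \<in> D" "b \<noteq> 0" "\<And>j. j \<in> J \<Longrightarrow> divides_in D b (a * j)"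
  shows "divides_in D b (a * x)"
  using assms by (auto simp: v_hull_def)

lemma v_hull_extensive: "J \<subseteq> D \<Longrightarrow> J \<subseteq> v_hull D J"
  by (auto simp: v_hull_def)

lemma v_hull_minimal:
  assumes "J \<subseteq> v_hull D K"
  shows "v_hull D J \<subseteq> v_hull D K"
proof
  fix x assume x: "x \<in> v_hull D J"
  then have "x \<in> D" by (simp add: v_hull_def)
  then show "x \<in> v_hull D K"
    by (rule v_hullI) (use assms in \<open>blast intro: v_hullD[OF x] v_hullD\<close>)
qed

lemma v_hull_mono:
  assumes "J \<subseteq> K"
  shows "v_hull D J \<subseteq> v_hull D K"
proof
  fix x assume x: "x \<in> v_hull D J"
  then have "x \<in> D" by (simp add: v_hull_def)
  then show "x \<in> v_hull D K"
    by (rule v_hullI) (use assms in \<open>auto intro: v_hullD[OF x]\<close>)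
qed

lemma v_hull_mult:
  assumes "subdomain D" "x \<in> v_hull D J" "c \<in> D"
  shows "c * x \<in> v_hull D ((*) c ` J)"
proof (rule v_hullI)
  have "x \<in> D" using assms(2) v_hull_subset by blast
  then show "c * x \<in> D" by (simp add: subdomain_closed[OF assms(1)] assms(3))
next
  fix a b assume *: "a \<in> D" "b \<in> D" "b \<noteq> 0" "\<And>j. j \<in> (*) c ` J \<Longrightarrow> divides_in D b (a * j)"
  have "divides_in D b ((a * c) * x)"
    by (rule v_hullD[OF assms(2)])
      (use * in \<open>auto simp: mult.assoc intro: subdomain_closed[OF assms(1)] assms(3)\<close>)
  then show "divides_in D b (a * (c * x))" by (simp add: mult.assoc)
qed

lemma v_hull_add:
  assumes "subdomain D" "x \<in> v_hull D J" "y \<in> v_hull D J"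
  shows "x + y \<in> v_hull D J"
proof (rule v_hullI)
  show "x + y \<in> D"
    using assms(2,3) v_hull_subset subdomain_closed(6)[OF assms(1)] by blast
next
  fix a b assume *: "a \<in> D" "b \<in> D" "b \<noteq> 0" "\<And>j. j \<in> J \<Longrightarrow> divides_in D b (a * j)"
  show "divides_in D b (a * (x + y))"
    unfolding distrib_left
    by (rule divides_in_add[OF assms(1)]) (use * assms(2,3) in \<open>auto intro: v_hullD\<close>)
qed

lemma v_hull_scale:
  assumes "subdomain D" "x \<in> v_hull D J" "r \<in> D"
  shows "r * x \<in> v_hull D J"
proof (rule v_hullI)
  show "r * x \<in> D"
    using assms(2,3) v_hull_subset subdomain_closed(4)[OF assms(1)] by blast
next
  fix a b assume *: "a \<in> D" "b \<in> D" "b \<noteq> 0" "\<And>j. j \<in> J \<Longrightarrow> divides_in D b (a * j)"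
  have "divides_in D b (a * x)"
    by (rule v_hullD[OF assms(2)]) (use * in auto)
  from divides_in_mult[OF assms(1) this assms(3)] show "divides_in D b (a * (r * x))"
    by (simp add: mult.left_commute)
qed

lemma v_hull_zero: "subdomain D \<Longrightarrow> 0 \<in> v_hull D J"
  by (rule v_hullI) (auto simp: divides_in_def subdomain_closed(1) intro!: bexI[of _ 0])

lemma t_closed_v_hull:
  assumes "t_closed D M" "finite J" "J \<subseteq> M" "j \<in> J" "j \<noteq> 0"
  shows "v_hull D J \<subseteq> M"
  using assms unfolding t_closed_def by blast

text \<open>Sums and multiples of \<open>x\<close> and \<open>y\<close> lie in the \<open>v\<close>-hull of \<open>{x, y, j}\<close>; the nonzero \<open>j\<close> is there because
  only finite sets with a nonzero element occur in the definition.\<close>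
lemma t_closed_ideal:
  assumes D: "subdomain D" and M: "t_closed D M"
  shows "M \<subseteq> D" "0 \<in> M" "x \<in> M \<Longrightarrow> y \<in> M \<Longrightarrow> x + y \<in> M" "r \<in> D \<Longrightarrow> x \<in> M \<Longrightarrow> r * x \<in> M"
    "x \<in> M \<Longrightarrow> y \<in> M \<Longrightarrow> x - y \<in> M"
proof -
  show sub: "M \<subseteq> D" using M by (simp add: t_closed_def)
  obtain j where j: "j \<in> M" "j \<noteq> 0" using M by (auto simp: t_closed_def)
  have hull: "v_hull D {x, y, j} \<subseteq> M" if "x \<in> M" "y \<in> M" for x y
    by (rule t_closed_v_hull[OF M, of _ j]) (use that j in auto)
  have ext: "x \<in> v_hull D {x, y, j}" "y \<in> v_hull D {x, y, j}" if "x \<in> M" "y \<in> M" for x y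
    using v_hull_extensive[of "{x, y, j}" D] that j sub by blast+
  show "0 \<in> M" using hull[OF j(1) j(1)] v_hull_zero[OF D] by blast
  show a: "\<And>x y. x \<in> M \<Longrightarrow> y \<in> M \<Longrightarrow> x + y \<in> M"
    using hull ext v_hull_add[OF D] by blast
  show r: "\<And>r x. r \<in> D \<Longrightarrow> x \<in> M \<Longrightarrow> r * x \<in> M"
    using hull ext v_hull_scale[OF D] by blast
  show "\<And>x y. x \<in> M \<Longrightarrow> y \<in> M \<Longrightarrow> x - y \<in> M"
    using a r[of "- 1"] subdomain_closed(2,5)[OF D] by fastforce
qed

lemma t_hullI: "finite J \<Longrightarrow> J \<subseteq> S \<Longrightarrow> j \<in> J \<Longrightarrow> j \<noteq> 0 \<Longrightarrow> x \<in> v_hull D J \<Longrightarrow> x \<in> t_hull D S"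
  by (auto simp: t_hull_def)

lemma t_hullE:
  assumes "x \<in> t_hull D S"
  obtains J j where "finite J" "J \<subseteq> S" "j \<in> J" "j \<noteq> 0" "x \<in> v_hull D J"
  using assms by (auto simp: t_hull_def)

lemma t_hull_extensive:
  assumes "S \<subseteq> D" "s \<in> S" "s \<noteq> 0"
  shows "S \<subseteq> t_hull D S"
proof
  fix x assume "x \<in> S"
  then show "x \<in> t_hull D S"
    using v_hull_extensive[of "{s, x}" D] assms by (intro t_hullI[of "{s, x}"]) auto
qed

text \<open>Finitely many elements of the hull lie in the \<open>v\<close>-hull of one finite set, namely the union of
  the finite sets that put each of them there.\<close>
lemma t_closed_t_hull:
  assumes "S \<subseteq> D" "s \<in> S" "s \<noteq> 0"
  shows "t_closed D (t_hull D S)"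
  unfolding t_closed_def
proof (intro conjI allI impI)
  show "t_hull D S \<subseteq> D" using v_hull_subset by (auto elim!: t_hullE)
  show "\<exists>x\<in>t_hull D S. x \<noteq> 0" using t_hull_extensive[OF assms] assms by blast
next
  fix J assume J: "finite J \<and> J \<subseteq> t_hull D S \<and> (\<exists>j\<in>J. j \<noteq> 0)"
  have "\<forall>j\<in>J. \<exists>K. finite K \<and> K \<subseteq> S \<and> j \<in> v_hull D K"
  proof
    fix j assume "j \<in> J"
    then have "j \<in> t_hull D S" using J by blast
    then show "\<exists>K. finite K \<and> K \<subseteq> S \<and> j \<in> v_hull D K" by (rule t_hullE) auto
  qed
  then obtain K where K: "\<forall>j\<in>J. finite (K j) \<and> K j \<subseteq> S \<and> j \<in> v_hull D (K j)"
    by metis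
  define U where "U = insert s (\<Union> (K ` J))"
  have U: "finite U" "U \<subseteq> S" "s \<in> U" using J K assms(2) by (auto simp: U_def)
  have "J \<subseteq> v_hull D U"
  proof
    fix j assume "j \<in> J"
    then have "j \<in> v_hull D (K j)" "K j \<subseteq> U" using K by (auto simp: U_def)
    then show "j \<in> v_hull D U" using v_hull_mono by blast
  qed
  then have "v_hull D J \<subseteq> v_hull D U" by (rule v_hull_minimal)
  then show "v_hull D J \<subseteq> t_hull D S"
    using t_hullI[OF U(1,2,3) assms(3)] by blast
qed

lemma t_maximalD:
  assumes "M \<in> t_maximal D"
  shows "t_closed D M" "1 \<notin> M" "t_closed D N \<Longrightarrow> 1 \<notin> N \<Longrightarrow> M \<subseteq> N \<Longrightarrow> N = M"
  using assms by (auto simp: t_maximal_def)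

text \<open>Zorn's lemma applies because being \<open>t\<close>-closed only concerns finite subsets.\<close>
lemma ex_t_maximal:
  assumes I: "t_closed D I" "1 \<notin> I"
  obtains M where "M \<in> t_maximal D" "I \<subseteq> M"
proof -
  define A where "A = {N. t_closed D N \<and> 1 \<notin> N \<and> I \<subseteq> N}"
  have "\<exists>M\<in>A. \<forall>X\<in>A. M \<subseteq> X \<longrightarrow> X = M"
  proof (rule subset_Zorn_nonempty)
    show "A \<noteq> {}" using I by (auto simp: A_def)
  next
    fix C assume C: "C \<noteq> {}" "subset.chain A C"
    then have CA: "C \<subseteq> A" by (simp add: subset.chain_def)
    obtain N0 where N0: "N0 \<in> C" using C by blast
    have "t_closed D (\<Union>C)"
      unfolding t_closed_def
    proof (intro conjI allI impI)
      show "\<Union>C \<subseteq> D" using CA by (auto simp: A_def t_closed_def)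
      have "t_closed D N0" using N0 CA by (auto simp: A_def)
      then show "\<exists>x\<in>\<Union>C. x \<noteq> 0" using N0 unfolding t_closed_def by blast
    next
      fix J assume J: "finite J \<and> J \<subseteq> \<Union>C \<and> (\<exists>j\<in>J. j \<noteq> 0)"
      then obtain N where N: "N \<in> C" "J \<subseteq> N"
        using finite_subset_Union_chain[of J C A] C by blast
      then have "t_closed D N" using CA by (auto simp: A_def)
      then have "v_hull D J \<subseteq> N" using J N(2) unfolding t_closed_def by blast
      then show "v_hull D J \<subseteq> \<Union>C" using N(1) by blast
    qed
    then show "\<Union>C \<in> A" using CA N0 by (auto simp: A_def)
  qed
  then obtain M where M: "M \<in> A" "\<And>X. X \<in> A \<Longrightarrow> M \<subseteq> X \<Longrightarrow> X = M" by blast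
  then have "M \<in> t_maximal D" "I \<subseteq> M" by (auto simp: A_def t_maximal_def)
  then show ?thesis by (rule that)
qed

text \<open>If \<open>x \<notin> M\<close> then \<open>1 \<in> J\<^sub>v\<close> for some finite \<open>J \<subseteq> M \<union> {x}\<close>; multiplying by \<open>y\<close> gives
  \<open>y \<in> (yJ)\<^sub>v\<close>, and \<open>yJ \<subseteq> M\<close> as soon as \<open>xy \<in> M\<close>.\<close>
lemma t_maximal_prime:
  assumes D: "subdomain D" and M: "M \<in> t_maximal D"
    and "x \<in> D" "y \<in> D" "x * y \<in> M"
  shows "x \<in> M \<or> y \<in> M"
proof (rule ccontr)
  note tM = t_maximalD(1)[OF M]
  note ideal = t_closed_ideal[OF D tM]
  assume "\<not> (x \<in> M \<or> y \<in> M)"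
  then have x: "x \<notin> M" and y: "y \<notin> M" by auto
  have x0: "x \<noteq> 0" and y0: "y \<noteq> 0" using x y ideal(2) by auto
  let ?H = "t_hull D (insert x M)"
  have S: "insert x M \<subseteq> D" using ideal(1) \<open>x \<in> D\<close> by auto
  have H: "t_closed D ?H" by (rule t_closed_t_hull[OF S _ x0]) auto
  have "insert x M \<subseteq> ?H" by (rule t_hull_extensive[OF S _ x0]) auto
  then have "1 \<in> ?H" using t_maximalD(3)[OF M H] x by auto
  then obtain J j where J: "finite J" "J \<subseteq> insert x M" "j \<in> J" "j \<noteq> 0" "1 \<in> v_hull D J"
    by (rule t_hullE)
  have "y * 1 \<in> v_hull D ((*) y ` J)" by (rule v_hull_mult[OF D J(5) \<open>y \<in> D\<close>])
  moreover have "(*) y ` J \<subseteq> M"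
    using J(2) assms(5) ideal(4)[OF \<open>y \<in> D\<close>] by (auto simp: mult.commute)
  then have "v_hull D ((*) y ` J) \<subseteq> M"
    using t_closed_v_hull[OF tM, of "(*) y ` J" "y * j"] J y0 by auto
  ultimately show False using y by auto
qed

lemma t_maximal_power:
  assumes D: "subdomain D" and M: "M \<in> t_maximal D" and "x \<in> D" "x \<notin> M"
  shows "x ^ k \<notin> M"
proof (induction k)
  case 0
  then show ?case using t_maximalD(2)[OF M] by simp
next
  case (Suc k)
  then show ?case
    using t_maximal_prime[OF D M \<open>x \<in> D\<close>, of "x ^ k"] assms(4) subdomain_closed(7)[OF D \<open>x \<in> D\<close>]
    by auto
qed

text \<open>The conductor \<open>{s \<in> D. b dvd a s}\<close> is a proper \<open>t\<close>-ideal containing \<open>J\<close> for suitable \<open>a\<close>, \<open>b\<close>,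
  because \<open>1 \<notin> J\<^sub>v\<close>; the only \<open>t\<close>-maximal ideal above it is \<open>M\<close>.\<close>
lemma isolated_if_finite_subset:
  assumes D: "subdomain D" and M: "M \<in> t_maximal D"
    and J: "finite J" "J \<subseteq> M" "j \<in> J" "j \<noteq> 0"
    and only: "\<And>N. N \<in> t_maximal D \<Longrightarrow> J \<subseteq> N \<Longrightarrow> N = M"
  shows "isolated D M"
proof -
  note tM = t_maximalD(1)[OF M]
  note MD = t_closed_ideal(1)[OF D tM]
  have "1 \<notin> v_hull D J"
    using t_closed_v_hull[OF tM J] t_maximalD(2)[OF M] by blast
  then obtain a b where ab: "a \<in> D" "b \<in> D" "b \<noteq> 0" "\<And>j. j \<in> J \<Longrightarrow> divides_in D b (a * j)"
      "\<not> divides_in D b a"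
    using subdomain_closed(2)[OF D] by (auto simp: v_hull_def)
  define I where "I = {s \<in> D. divides_in D b (a * s)}"
  have JI: "J \<subseteq> I" using ab(4) J(2) MD by (auto simp: I_def)
  have I: "t_closed D I"
    unfolding t_closed_def
  proof (intro conjI allI impI)
    show "I \<subseteq> D" by (auto simp: I_def)
    show "\<exists>x\<in>I. x \<noteq> 0" using JI J by blast
    show "v_hull D K \<subseteq> I" if K: "finite K \<and> K \<subseteq> I \<and> (\<exists>j\<in>K. j \<noteq> 0)" for K
    proof
      fix x assume x: "x \<in> v_hull D K"
      have "divides_in D b (a * x)"
        by (rule v_hullD[OF x ab(1,2,3)]) (use K in \<open>auto simp: I_def\<close>)
      then show "x \<in> I" using x v_hull_subset by (auto simp: I_def)
    qed
  qed
  obtain N where N: "N \<in> t_maximal D" "I \<subseteq> N"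
    using ex_t_maximal[OF I] ab(5) by (auto simp: I_def)
  then have "I \<subseteq> M" using only[of N] JI by auto
  show ?thesis
    unfolding isolated_def
  proof (rule bexI[OF _ ab(1)], rule bexI[of _ b], intro conjI ballI)
    show "b \<in> D - {0}" using ab by auto
    show "\<not> divides_in D b (a * s)" if "s \<in> D - M" for s
      using that \<open>I \<subseteq> M\<close> by (auto simp: I_def)
    show "\<exists>s\<in>D - N. divides_in D b (a * s)" if "N \<in> t_maximal D - {M}" for N
      using that only[of N] ab(4) MD J(2) by blast
  qed
qed

section \<open>Comparison with fractional ideals\<close>

lemma quotient_field_contains:
  assumes "subdomain D" "x \<in> D"
  shows "x \<in> quotient_field D"
  unfolding quotient_field_def
  by (rule CollectI, rule exI[of _ x], rule exI[of _ 1])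
    (use assms subdomain_closed(2)[OF assms(1)] in auto)

lemma divides_in_field_iff:
  fixes D :: "'k::field set"
  assumes "b \<noteq> 0"
  shows "divides_in D b (a * j) \<longleftrightarrow> a / b * j \<in> D"
proof
  assume "divides_in D b (a * j)"
  then obtain r where "r \<in> D" "a * j = b * r" by (auto simp: divides_in_def)
  then show "a / b * j \<in> D" using assms by (simp add: field_simps)
next
  assume "a / b * j \<in> D"
  then show "divides_in D b (a * j)"
    unfolding divides_in_def using assms by (intro bexI[of _ "a / b * j"]) auto
qed

definition D_span :: "'k::field set \<Rightarrow> 'k set \<Rightarrow> 'k set" where
  "D_span D B = {\<Sum>b\<in>B. c b * b | c. \<forall>b\<in>B. c b \<in> D}"

lemma D_span_contains:
  assumes D: "subdomain D" and "finite B"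
  shows "B \<subseteq> D_span D B"
proof
  fix b assume "b \<in> B"
  then have "b = (\<Sum>x\<in>B. (if x = b then 1 else 0) * x)"
    using assms(2) by (simp add: if_distrib if_distribR cong: if_cong)
  then show "b \<in> D_span D B"
    unfolding D_span_def using subdomain_closed(1,2)[OF D]
    by (intro CollectI exI[of _ "\<lambda>x. if x = b then 1 else 0"]) auto
qed

text \<open>A fraction carries a finitely generated module into \<open>D\<close> iff it does so with the generators. The \<open>v\<close>-closure
  stays inside \<open>D\<close> because \<open>1\<close> belongs to the inverse of any subset of \<open>D\<close>.\<close>
lemma v_closure_D_span:
  fixes D :: "'k::field set"
  assumes D: "subdomain D" and B: "finite B" "B \<subseteq> D"
  shows "v_closure D (D_span D B) = v_hull D B"
proof -
  have inv: "y \<in> ideal_inverse D (D_span D B) \<longleftrightarrow>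
      (\<exists>a\<in>D. \<exists>b\<in>D - {0}. y = a / b \<and> (\<forall>j\<in>B. divides_in D b (a * j)))" (is "?l \<longleftrightarrow> ?r") for y
  proof
    assume l: ?l
    then obtain a b where ab: "a \<in> D" "b \<in> D" "b \<noteq> 0" "y = a / b"
      by (auto simp: ideal_inverse_def quotient_field_def)
    moreover have "y * j \<in> D" if "j \<in> B" for j
      using l D_span_contains[OF D B(1)] that by (auto simp: ideal_inverse_def)
    ultimately have "\<forall>j\<in>B. divides_in D b (a * j)" by (simp add: divides_in_field_iff)
    then show ?r using ab by blast
  next
    assume ?r
    then obtain a b where ab: "a \<in> D" "b \<in> D" "b \<noteq> 0" "y = a / b"
      and dvd: "\<forall>j\<in>B. divides_in D b (a * j)"
      by auto
    have j: "y * j \<in> D" if "j \<in> B" for j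
      using dvd that unfolding ab(4) divides_in_field_iff[OF ab(3)] by blast
    have "y * (\<Sum>b\<in>B. c b * b) \<in> D" if "\<forall>b\<in>B. c b \<in> D" for c
    proof -
      have "y * (\<Sum>b\<in>B. c b * b) = (\<Sum>b\<in>B. c b * (y * b))"
        by (simp add: sum_distrib_left mult.left_commute)
      also have "\<dots> \<in> D"
        by (rule subdomain_sum[OF D], rule subdomain_closed(4)[OF D]) (use that j in auto)
      finally show ?thesis .
    qed
    then show ?l using ab by (auto simp: ideal_inverse_def quotient_field_def D_span_def)
  qed
  show ?thesis
  proof (rule set_eqI, rule iffI)
    fix x assume x: "x \<in> v_closure D (D_span D B)"
    have *: "a / b * x \<in> D"
      if "a \<in> D" "b \<in> D" "b \<noteq> 0" "\<forall>j\<in>B. divides_in D b (a * j)" for a b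
    proof -
      have "a / b \<in> ideal_inverse D (D_span D B)" unfolding inv using that by blast
      then show ?thesis using x
        by (auto simp: v_closure_def ideal_inverse_def[of _ "ideal_inverse _ _"] mult.commute)
    qed
    \<comment> \<open>The choice \<open>a = b = 1\<close> shows that the \<open>v\<close>-closure stays inside \<open>D\<close>.\<close>
    have "1 / 1 * x \<in> D"
      by (rule *) (use B(2) subdomain_closed(2)[OF D] in \<open>auto simp: divides_in_def\<close>)
    then have xD: "x \<in> D" by simp
    then show "x \<in> v_hull D B"
      by (rule v_hullI) (use * in \<open>simp add: divides_in_field_iff\<close>)
  next
    fix x assume x: "x \<in> v_hull D B"
    then have "x \<in> D" using v_hull_subset by blast
    moreover have "x * y \<in> D" if y: "y \<in> ideal_inverse D (D_span D B)" for y
    proof -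
      obtain a b where ab: "a \<in> D" "b \<in> D" "b \<noteq> 0" "y = a / b" "\<forall>j\<in>B. divides_in D b (a * j)"
        using y inv by blast
      then have "divides_in D b (a * x)" by (intro v_hullD[OF x]) auto
      then show ?thesis using ab divides_in_field_iff[of b D a x] by (simp add: mult.commute)
    qed
    ultimately show "x \<in> v_closure D (D_span D B)"
      using quotient_field_contains[OF D]
      by (auto simp: v_closure_def ideal_inverse_def[of _ "ideal_inverse _ _"])
  qed
qed

lemma D_span_minimal:
  assumes D: "subdomain D" and M: "submodule_of_qf D M" and "B \<subseteq> M"
  shows "D_span D B \<subseteq> M"
proof -
  have M0: "0 \<in> M" "\<And>x y. x \<in> M \<Longrightarrow> y \<in> M \<Longrightarrow> x + y \<in> M" "\<And>r x. r \<in> D \<Longrightarrow> x \<in> M \<Longrightarrow> r * x \<in> M"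
    using M by (auto simp: submodule_of_qf_def)
  have "(\<Sum>b\<in>B. c b * b) \<in> M" if "\<forall>b\<in>B. c b \<in> D" for c
    using \<open>B \<subseteq> M\<close> that by (induction B rule: infinite_finite_induct) (auto intro: M0)
  then show ?thesis by (auto simp: D_span_def)
qed

lemma D_span_eq_zero_iff:
  assumes "subdomain D" "finite B"
  shows "D_span D B = {0} \<longleftrightarrow> B \<subseteq> {0}"
proof
  show "B \<subseteq> {0}" if "D_span D B = {0}"
    using D_span_contains[OF assms] that by simp
next
  assume B: "B \<subseteq> {0}"
  have "(\<Sum>b\<in>B. c b * b) = 0" for c
    by (rule sum.neutral) (use B in auto)
  then have "D_span D B = {0 | c. \<forall>b\<in>B. c b \<in> D}" by (simp add: D_span_def)
  also have "\<dots> = {0}"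
    using subdomain_closed(1)[OF assms(1)] by (auto intro: exI[of _ "\<lambda>_. 0"])
  finally show "D_span D B = {0}" .
qed

lemma t_closure_eq_t_hull:
  assumes D: "subdomain D" and M: "submodule_of_qf D M" "M \<subseteq> D"
  shows "t_closure D M = t_hull D M"
proof (rule set_eqI, rule iffI)
  fix x assume "x \<in> t_closure D M"
  then obtain B where B: "D_span D B \<subseteq> M" "D_span D B \<noteq> {0}" "finite B" "x \<in> v_closure D (D_span D B)"
    unfolding t_closure_def finitely_generated_ideal_def D_span_def by blast
  have BM: "B \<subseteq> M" using D_span_contains[OF D B(3)] B(1) by auto
  moreover have "x \<in> v_hull D B" using v_closure_D_span[OF D B(3)] BM M(2) B(4) by auto
  moreover obtain j where "j \<in> B" "j \<noteq> 0" using D_span_eq_zero_iff[OF D B(3)] B(2) by blast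
  ultimately show "x \<in> t_hull D M" using B(3) by (intro t_hullI)
next
  fix x assume "x \<in> t_hull D M"
  then obtain J j where J: "finite J" "J \<subseteq> M" "j \<in> J" "j \<noteq> 0" "x \<in> v_hull D J" by (rule t_hullE)
  have JD: "J \<subseteq> D" using J(2) M(2) by auto
  have "x \<in> v_closure D (D_span D J)" using v_closure_D_span[OF D J(1) JD] J(5) by simp
  moreover have "D_span D J \<noteq> {0}" using D_span_eq_zero_iff[OF D J(1)] J(3,4) by auto
  moreover have "finitely_generated_ideal D (D_span D J)"
    unfolding finitely_generated_ideal_def D_span_def
    using J(1) JD quotient_field_contains[OF D] by blast
  ultimately show "x \<in> t_closure D M"
    unfolding t_closure_def using D_span_minimal[OF D M(1) J(2)] by blast
qed

lemma t_ideal_iff_t_closed: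
  assumes D: "subdomain D" and MD: "M \<subseteq> D"
  shows "t_ideal D M \<longleftrightarrow> t_closed D M"
proof
  assume t: "t_ideal D M"
  then have sub: "submodule_of_qf D M" and "M \<noteq> {0}" and cl: "t_closure D M = M"
    by (auto simp: t_ideal_def nonzero_fractional_ideal_def)
  then have "\<exists>x\<in>M. x \<noteq> 0" by (auto simp: submodule_of_qf_def)
  moreover have "t_hull D M = M" using t_closure_eq_t_hull[OF D sub MD] cl by simp
  ultimately show "t_closed D M"
    unfolding t_closed_def using MD by (auto intro: t_hullI)
next
  assume t: "t_closed D M"
  note id = t_closed_ideal[OF D t]
  have sub: "submodule_of_qf D M"
    unfolding submodule_of_qf_def
  proof (intro conjI ballI)
    show "M \<subseteq> quotient_field D" using MD quotient_field_contains[OF D] by blast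
  qed (use id(2-4) in auto)
  obtain s where s: "s \<in> M" "s \<noteq> 0" using t by (auto simp: t_closed_def)
  have "t_hull D M = M"
  proof
    show "t_hull D M \<subseteq> M"
    proof
      fix x assume "x \<in> t_hull D M"
      then obtain J j where J: "finite J" "J \<subseteq> M" "j \<in> J" "j \<noteq> 0" "x \<in> v_hull D J"
        by (rule t_hullE)
      show "x \<in> M" using t_closed_v_hull[OF t J(1-4)] J(5) by blast
    qed
  qed (rule t_hull_extensive[OF MD s])
  then have "t_closure D M = M" using t_closure_eq_t_hull[OF D sub MD] by simp
  moreover have "\<exists>d\<in>D. d \<noteq> 0 \<and> (\<forall>x\<in>M. d * x \<in> D)"
    using MD subdomain_closed(2)[OF D] by (intro bexI[of _ 1]) auto
  ultimately show "t_ideal D M"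
    using sub s unfolding t_ideal_def nonzero_fractional_ideal_def by blast
qed

lemma t_Max_eq_t_maximal:
  assumes D: "subdomain D"
  shows "t_Max D = t_maximal D"
proof -
  have "t_ideal D M \<and> M \<subset> D \<longleftrightarrow> t_closed D M \<and> 1 \<notin> M" for M
  proof
    assume l: "t_ideal D M \<and> M \<subset> D"
    then have t: "t_closed D M" using t_ideal_iff_t_closed[OF D] by blast
    have "1 \<notin> M"
    proof
      assume "1 \<in> M"
      then have "D \<subseteq> M" using t_closed_ideal(4)[OF D t _ \<open>1 \<in> M\<close>] by auto
      then show False using l by auto
    qed
    then show "t_closed D M \<and> 1 \<notin> M" using t by simp
  next
    assume r: "t_closed D M \<and> 1 \<notin> M"
    then have "M \<subset> D" using subdomain_closed(2)[OF D] by (auto simp: t_closed_def)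
    then show "t_ideal D M \<and> M \<subset> D" using r t_ideal_iff_t_closed[OF D, of M] by auto
  qed
  then show ?thesis unfolding t_Max_def t_maximal_def by blast
qed

lemma localization_at_iff:
  fixes D :: "'k::field set"
  assumes "subdomain D" "0 \<in> M" "b \<noteq> 0"
  shows "a / b \<in> localization_at D M \<longleftrightarrow> (\<exists>s\<in>D - M. divides_in D b (a * s))"
proof
  assume "a / b \<in> localization_at D M"
  then obtain r s where rs: "r \<in> D" "s \<in> D" "s \<notin> M" "a / b = r / s"
    unfolding localization_at_def by blast
  have "s \<noteq> 0" using rs(3) assms(2) by metis
  then have "a * s = r * b" using frac_eq_eq[OF assms(3), of s a r] rs(4) by blast
  then have "a * s = b * r" by (simp only: mult.commute)
  then show "\<exists>s\<in>D - M. divides_in D b (a * s)"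
    unfolding divides_in_def using rs(1-3) by blast
next
  assume "\<exists>s\<in>D - M. divides_in D b (a * s)"
  then obtain r s where rs: "r \<in> D" "s \<in> D" "s \<notin> M" "a * s = b * r"
    unfolding divides_in_def by blast
  have "s \<noteq> 0" using rs(3) assms(2) by metis
  moreover have "a * s = r * b" using rs(4) by (simp only: mult.commute)
  ultimately have "a / b = r / s" using frac_eq_eq[OF assms(3), of s a r] by blast
  then show "a / b \<in> localization_at D M" unfolding localization_at_def using rs(1-3) by blast
qed

lemma isolated_iff_localization:
  fixes D :: "'k::field set"
  assumes D: "subdomain D" and M: "M \<in> t_maximal D"
  shows "isolated D M \<longleftrightarrow>
    (\<exists>x\<in>inter_localizations D (t_maximal D - {M}). x \<notin> localization_at D M)"
proof -
  have 0: "0 \<in> N" if "N \<in> t_maximal D" for N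
    using t_closed_ideal(2)[OF D] t_maximalD(1)[OF that] by blast
  have "isolated D M \<longleftrightarrow> (\<exists>a\<in>D. \<exists>b\<in>D - {0}. a / b \<notin> localization_at D M \<and>
      (\<forall>N\<in>t_maximal D - {M}. a / b \<in> localization_at D N))"
    unfolding isolated_def
    using localization_at_iff[OF D 0[OF M]] localization_at_iff[OF D 0] by auto
  also have "\<dots> \<longleftrightarrow> (\<exists>x\<in>quotient_field D. x \<notin> localization_at D M \<and>
      (\<forall>N\<in>t_maximal D - {M}. x \<in> localization_at D N))"
    unfolding quotient_field_def by blast
  finally show ?thesis by (auto simp: inter_localizations_def)
qed

text \<open>Removing \<open>M\<close> from the full set of maximal \<open>t\<close>-ideals changes the intersection iff \<open>M\<close> is isolated. If
  all are isolated, then two families that differ in \<open>M\<close> are told apart by the fraction isolating \<open>M\<close>.\<close>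
lemma t_sharp_in_field_iff_isolated:
  fixes D :: "'k::field set"
  assumes D: "subdomain D"
  shows "t_sharp_in_field D \<longleftrightarrow> (\<forall>M\<in>t_maximal D. isolated D M)"
proof
  assume sharp: "t_sharp_in_field D"
  show "\<forall>M\<in>t_maximal D. isolated D M"
  proof
    fix M assume M: "M \<in> t_maximal D"
    have "inter_localizations D (t_maximal D) \<noteq> inter_localizations D (t_maximal D - {M})"
      using sharp M unfolding t_sharp_in_field_def t_Max_eq_t_maximal[OF D] by blast
    then show "isolated D M"
      unfolding isolated_iff_localization[OF D M] by (auto simp: inter_localizations_def)
  qed
next
  assume iso: "\<forall>M\<in>t_maximal D. isolated D M"
  have *: "inter_localizations D A \<noteq> inter_localizations D B"
    if AB: "A \<subseteq> t_maximal D" "B \<subseteq> t_maximal D" and M: "M \<in> A" "M \<notin> B" for A B M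
  proof -
    have "M \<in> t_maximal D" using AB M by auto
    then obtain x where x: "x \<in> inter_localizations D (t_maximal D - {M})" "x \<notin> localization_at D M"
      using iso isolated_iff_localization[OF D] by blast
    have "x \<in> inter_localizations D B" using x(1) AB(2) M(2) by (auto simp: inter_localizations_def)
    moreover have "x \<notin> inter_localizations D A" using x(2) M(1) by (auto simp: inter_localizations_def)
    ultimately show ?thesis by blast
  qed
  show "t_sharp_in_field D"
    unfolding t_sharp_in_field_def t_Max_eq_t_maximal[OF D]
  proof (intro allI impI)
    fix A B assume AB: "A \<subseteq> t_maximal D \<and> B \<subseteq> t_maximal D \<and> A \<noteq> B"
    then consider M where "M \<in> A" "M \<notin> B" | M where "M \<in> B" "M \<notin> A" by blast
    then show "inter_localizations D A \<noteq> inter_localizations D B"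
      by cases (use AB *[of A B] *[of B A] in blast)+
  qed
qed

section \<open>Invariance under injective ring homomorphisms\<close>

text \<open>Isolation is transported along two embeddings: of a domain into its field of fractions, and of \<open>R\<close> into the
  polynomials as the constants.\<close>
locale injective_ring_hom =
  fixes \<phi> :: "'a::idom \<Rightarrow> 'b::idom"
  assumes inj: "inj \<phi>"
    and hom_one: "\<phi> 1 = 1"
    and hom_diff: "\<phi> (x - y) = \<phi> x - \<phi> y"
    and hom_mult: "\<phi> (x * y) = \<phi> x * \<phi> y"
begin

lemma eq_iff [simp]: "\<phi> x = \<phi> y \<longleftrightarrow> x = y"
  using inj by (auto simp: inj_def)

lemma hom_zero: "\<phi> 0 = 0"
  using hom_diff[of 0 0] by simp

lemma eq_zero_iff [simp]: "\<phi> x = 0 \<longleftrightarrow> x = 0"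
  using eq_iff[of x 0] hom_zero by simp

lemma mem_image_iff [simp]: "\<phi> x \<in> \<phi> ` S \<longleftrightarrow> x \<in> S"
  by auto

lemma subdomain_image: "subdomain D \<Longrightarrow> subdomain (\<phi> ` D)"
  unfolding subdomain_def
  using mem_image_iff[of 1 D] by (auto simp: hom_one hom_diff[symmetric] hom_mult[symmetric])

lemma divides_in_image: "divides_in (\<phi> ` D) (\<phi> b) (\<phi> x) \<longleftrightarrow> divides_in D b x"
  by (auto simp: divides_in_def hom_mult[symmetric])

lemma v_hull_image: "v_hull (\<phi> ` D) (\<phi> ` J) = \<phi> ` v_hull D J"
proof -
  have "\<phi> ` D - {0} = \<phi> ` (D - {0})" by auto
  then show ?thesis
    unfolding v_hull_def
    by (auto simp: hom_mult[symmetric] divides_in_image)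
qed

lemma t_closed_image:
  "t_closed (\<phi> ` D) (\<phi> ` M) \<longleftrightarrow> t_closed D M"
proof -
  have "(\<forall>J. finite J \<and> J \<subseteq> \<phi> ` M \<and> (\<exists>j\<in>J. j \<noteq> 0) \<longrightarrow> v_hull (\<phi> ` D) J \<subseteq> \<phi> ` M) \<longleftrightarrow>
      (\<forall>J. finite J \<and> J \<subseteq> M \<and> (\<exists>j\<in>J. j \<noteq> 0) \<longrightarrow> v_hull D J \<subseteq> M)" (is "?l \<longleftrightarrow> ?r")
  proof
    assume l: ?l
    show ?r
    proof (intro allI impI)
      fix J assume "finite J \<and> J \<subseteq> M \<and> (\<exists>j\<in>J. j \<noteq> 0)"
      then have "v_hull (\<phi> ` D) (\<phi> ` J) \<subseteq> \<phi> ` M" using l[rule_format, of "\<phi> ` J"] by auto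
      then show "v_hull D J \<subseteq> M" by (simp add: v_hull_image inj inj_image_subset_iff)
    qed
  next
    assume r: ?r
    show ?l
    proof (intro allI impI)
      fix J assume J: "finite J \<and> J \<subseteq> \<phi> ` M \<and> (\<exists>j\<in>J. j \<noteq> 0)"
      then obtain K where K: "K \<subseteq> M" "finite K" "J = \<phi> ` K"
        by (metis finite_subset_image)
      then have "v_hull D K \<subseteq> M" using r[rule_format, of K] J by auto
      then show "v_hull (\<phi> ` D) J \<subseteq> \<phi> ` M" by (auto simp: K(3) v_hull_image)
    qed
  qed
  then show ?thesis
    unfolding t_closed_def by (simp add: inj inj_image_subset_iff)
qed

lemma t_maximal_image: "t_maximal (\<phi> ` D) = (`) \<phi> ` t_maximal D"
proof -
  have sub: "\<exists>M. N = \<phi> ` M" if "t_closed (\<phi> ` D) N" for N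
    using that by (metis t_closed_def subset_imageE)
  have one: "1 \<in> \<phi> ` M \<longleftrightarrow> 1 \<in> M" for M
    using mem_image_iff[of 1 M] by (simp only: hom_one)
  have iff: "\<phi> ` M \<in> t_maximal (\<phi> ` D) \<longleftrightarrow> M \<in> t_maximal D" for M
  proof -
    have "(\<forall>N. t_closed (\<phi> ` D) N \<and> 1 \<notin> N \<and> \<phi> ` M \<subseteq> N \<longrightarrow> N = \<phi> ` M) \<longleftrightarrow>
        (\<forall>N. t_closed (\<phi> ` D) (\<phi> ` N) \<and> 1 \<notin> \<phi> ` N \<and> \<phi> ` M \<subseteq> \<phi> ` N \<longrightarrow> \<phi> ` N = \<phi> ` M)"
      using sub by metis
    then show ?thesis
      unfolding t_maximal_def
      by (simp add: t_closed_image one inj inj_image_subset_iff inj_image_eq_iff)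
  qed
  show ?thesis
  proof (rule set_eqI, rule iffI)
    fix N assume N: "N \<in> t_maximal (\<phi> ` D)"
    then obtain M where "N = \<phi> ` M" using sub t_maximalD(1) by blast
    then show "N \<in> (`) \<phi> ` t_maximal D" using N iff by blast
  qed (use iff in blast)
qed

lemma isolated_image: "isolated (\<phi> ` D) (\<phi> ` M) \<longleftrightarrow> isolated D M"
proof -
  have 1: "\<phi> ` D - {0} = \<phi> ` (D - {0})" by auto
  have 2: "\<phi> ` D - \<phi> ` N = \<phi> ` (D - N)" for N by auto
  have 3: "t_maximal (\<phi> ` D) - {\<phi> ` M} = (`) \<phi> ` (t_maximal D - {M})"
    unfolding t_maximal_image using inj by (auto simp: inj_image_eq_iff)
  show ?thesis
    unfolding isolated_def 1 2 3
    by (simp add: 2 hom_mult[symmetric] divides_in_image)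
qed

lemma all_isolated_image:
  "(\<forall>M\<in>t_maximal (\<phi> ` D). isolated (\<phi> ` D) M) \<longleftrightarrow> (\<forall>M\<in>t_maximal D. isolated D M)"
  by (simp add: t_maximal_image isolated_image)

end

lemma t_sharp_domain_iff_isolated:
  "t_sharp_domain D \<longleftrightarrow> subdomain D \<and> (\<forall>M\<in>t_maximal D. isolated D M)"
proof -
  interpret injective_ring_hom "to_fract :: 'a \<Rightarrow> 'a fract"
    by unfold_locales (auto simp: inj_def)
  show ?thesis
    unfolding t_sharp_domain_def
    using t_sharp_in_field_iff_isolated[OF subdomain_image, of D] all_isolated_image[of D] by auto
qed

section \<open>Extensions with a basis of monomials\<close>

definition is_ideal :: "'a::idom set \<Rightarrow> 'a set \<Rightarrow> bool" where
  "is_ideal D I \<longleftrightarrow> I \<subseteq> D \<and> 0 \<in> I \<and> (\<forall>x\<in>I. \<forall>y\<in>I. x - y \<in> I) \<and> (\<forall>r\<in>D. \<forall>x\<in>I. r * x \<in> I)"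

lemma is_idealD:
  assumes "is_ideal D I"
  shows "I \<subseteq> D" "0 \<in> I" "x \<in> I \<Longrightarrow> y \<in> I \<Longrightarrow> x - y \<in> I" "r \<in> D \<Longrightarrow> x \<in> I \<Longrightarrow> r * x \<in> I"
    "x \<in> I \<Longrightarrow> y \<in> I \<Longrightarrow> x + y \<in> I"
proof -
  show "I \<subseteq> D" and 0: "0 \<in> I" and d: "\<And>x y. x \<in> I \<Longrightarrow> y \<in> I \<Longrightarrow> x - y \<in> I"
    and "\<And>r x. r \<in> D \<Longrightarrow> x \<in> I \<Longrightarrow> r * x \<in> I"
    using assms by (auto simp: is_ideal_def)
  show "\<And>x y. x \<in> I \<Longrightarrow> y \<in> I \<Longrightarrow> x + y \<in> I"
    using d d[OF 0] by (metis diff_0 diff_minus_eq_add)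
qed

lemma ideal_sum:
  assumes "is_ideal D I" "\<And>i. i \<in> K \<Longrightarrow> f i \<in> I"
  shows "sum f K \<in> I"
  using assms(2)
  by (induction K rule: infinite_finite_induct) (auto intro: is_idealD[OF assms(1)])

lemma t_closed_is_ideal: "subdomain D \<Longrightarrow> t_closed D M \<Longrightarrow> is_ideal D M"
  using t_closed_ideal[of D M] unfolding is_ideal_def by blast

text \<open>This describes \<open>D\<close> as the polynomial ring over \<open>R\<close> with monomials \<open>mon t\<close>, where \<open>t\<close> ranges over the set
  of exponents \<open>T\<close>. Keeping \<open>R\<close> and \<open>D\<close> inside one type allows \<open>R\<close> to be itself a polynomial ring, so that
  \<open>R[X\<^sub>A]\<close> can be viewed over \<open>R[X\<^sub>F]\<close> for any \<open>F \<subseteq> A\<close>. The last axiom takes the place of a monomial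
  order: it provides a product of monomials that cannot cancel, as the product of leading monomials would.\<close>
locale monomial_basis =
  fixes R D :: "'r::idom set" and T :: "'t::comm_monoid_add set"
    and mon :: "'t \<Rightarrow> 'r" and coef :: "'r \<Rightarrow> 't \<Rightarrow> 'r"
  assumes subdomain_R: "subdomain R"
    and subdomain_D: "subdomain D"
    and R_subset: "R \<subseteq> D"
    and exp_zero: "0 \<in> T"
    and exp_add: "s \<in> T \<Longrightarrow> t \<in> T \<Longrightarrow> s + t \<in> T"
    and mon_zero: "mon 0 = 1"
    and mon_add: "s \<in> T \<Longrightarrow> t \<in> T \<Longrightarrow> mon (s + t) = mon s * mon t"
    and mon_mem: "t \<in> T \<Longrightarrow> mon t \<in> D"
    and coef_mem: "f \<in> D \<Longrightarrow> coef f t \<in> R"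
    and support_finite: "f \<in> D \<Longrightarrow> finite {t. coef f t \<noteq> 0}"
    and support_subset: "f \<in> D \<Longrightarrow> coef f t \<noteq> 0 \<Longrightarrow> t \<in> T"
    and expansion: "f \<in> D \<Longrightarrow> f = (\<Sum>t\<in>{t. coef f t \<noteq> 0}. coef f t * mon t)"
    and coef_diff: "f \<in> D \<Longrightarrow> g \<in> D \<Longrightarrow> coef (f - g) t = coef f t - coef g t"
    and coef_monomial: "r \<in> R \<Longrightarrow> s \<in> T \<Longrightarrow> coef (r * mon s) t = (if t = s then r else 0)"
    and unique_sum: "finite M \<Longrightarrow> finite N \<Longrightarrow> M \<noteq> {} \<Longrightarrow> N \<noteq> {} \<Longrightarrow> M \<subseteq> T \<Longrightarrow> N \<subseteq> T \<Longrightarrow>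
      \<exists>m\<in>M. \<exists>n\<in>N. \<forall>m'\<in>M. \<forall>n'\<in>N. m' + n' = m + n \<longrightarrow> m' = m \<and> n' = n"
begin

lemmas R_closed = subdomain_closed[OF subdomain_R]
lemmas D_closed = subdomain_closed[OF subdomain_D]

lemma R_in_D: "r \<in> R \<Longrightarrow> r \<in> D"
  using R_subset by auto

abbreviation supp :: "'r \<Rightarrow> 't set" where
  "supp f \<equiv> {t. coef f t \<noteq> 0}"

lemma coef_zero [simp]: "coef 0 t = 0"
  using coef_diff[OF D_closed(1) D_closed(1), of t] by simp

lemma coef_add: "f \<in> D \<Longrightarrow> g \<in> D \<Longrightarrow> coef (f + g) t = coef f t + coef g t"
  using coef_diff[of f "0 - g" t] coef_diff[OF D_closed(1), of g t] D_closed(5)[of g] by simp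

lemma coef_sum: "(\<And>i. i \<in> I \<Longrightarrow> f i \<in> D) \<Longrightarrow> coef (sum f I) t = (\<Sum>i\<in>I. coef (f i) t)"
proof (induction I rule: infinite_finite_induct)
  case (insert i I)
  then show ?case
    using subdomain_sum[OF subdomain_D, of I f] by (simp add: coef_add)
qed auto

lemma monomial_mem: "r \<in> R \<Longrightarrow> t \<in> T \<Longrightarrow> r * mon t \<in> D"
  by (intro D_closed(4) R_in_D mon_mem)

lemma coef_const: "r \<in> R \<Longrightarrow> coef r t = (if t = 0 then r else 0)"
  using coef_monomial[OF _ exp_zero, of r t] by (simp add: mon_zero)

lemma coef_mult:
  assumes "f \<in> D" "g \<in> D"
  shows "coef (f * g) u =
    (\<Sum>s\<in>supp f. \<Sum>t\<in>supp g. if s + t = u then coef f s * coef g t else 0)"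
proof -
  have fg: "f * g = (\<Sum>s\<in>supp f. \<Sum>t\<in>supp g. (coef f s * coef g t) * mon (s + t))"
  proof -
    have "f * g = (\<Sum>s\<in>supp f. coef f s * mon s) * (\<Sum>t\<in>supp g. coef g t * mon t)"
      using expansion[OF assms(1)] expansion[OF assms(2)] by simp
    also have "\<dots> = (\<Sum>s\<in>supp f. \<Sum>t\<in>supp g. (coef f s * coef g t) * mon (s + t))"
      unfolding sum_product
      by (intro sum.cong refl) (use assms in \<open>simp add: mon_add support_subset algebra_simps\<close>)
    finally show ?thesis .
  qed
  have 1: "(coef f s * coef g t) * mon (s + t) \<in> D" if "s \<in> supp f" "t \<in> supp g" for s t
    using that assms
    by (intro monomial_mem R_closed(4) coef_mem exp_add) (auto intro: support_subset)
  have 2: "coef ((coef f s * coef g t) * mon (s + t)) u =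
      (if s + t = u then coef f s * coef g t else 0)" if "s \<in> supp f" "t \<in> supp g" for s t
    using that assms
    by (subst coef_monomial) (auto intro!: R_closed(4) coef_mem exp_add intro: support_subset)
  have "coef (f * g) u = (\<Sum>s\<in>supp f. coef (\<Sum>t\<in>supp g. (coef f s * coef g t) * mon (s + t)) u)"
    unfolding fg by (rule coef_sum, rule subdomain_sum[OF subdomain_D], rule 1)
  also have "\<dots> = (\<Sum>s\<in>supp f. \<Sum>t\<in>supp g. coef ((coef f s * coef g t) * mon (s + t)) u)"
    by (intro sum.cong refl coef_sum 1) auto
  also have "\<dots> = (\<Sum>s\<in>supp f. \<Sum>t\<in>supp g. if s + t = u then coef f s * coef g t else 0)"
    by (intro sum.cong refl 2) auto
  finally show ?thesis .
qed

lemma coef_scale: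
  assumes "r \<in> R" "f \<in> D"
  shows "coef (r * f) u = r * coef f u"
proof -
  have "coef (f * r) u = (\<Sum>s\<in>supp f. \<Sum>t\<in>supp r. if s + t = u then coef f s * coef r t else 0)"
    by (rule coef_mult[OF assms(2) R_in_D[OF assms(1)]])
  also have "\<dots> = (\<Sum>s\<in>supp f. if s = u then coef f s * r else 0)"
  proof (rule sum.cong[OF refl])
    fix s assume "s \<in> supp f"
    have "(\<Sum>t\<in>supp r. if s + t = u then coef f s * coef r t else 0) =
        (\<Sum>t\<in>{0}. if s + t = u then coef f s * coef r t else 0)"
      by (rule sum.mono_neutral_cong_left) (use assms(1) in \<open>auto simp: coef_const split: if_splits\<close>)
    then show "(\<Sum>t\<in>supp r. if s + t = u then coef f s * coef r t else 0) =
        (if s = u then coef f s * r else 0)"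
      using assms(1) by (simp add: coef_const)
  qed
  also have "\<dots> = coef f u * r"
    using support_finite[OF assms(2)] by (simp add: sum.delta')
  finally show ?thesis by (simp add: mult.commute)
qed

lemma supp_nonempty: "f \<in> D \<Longrightarrow> f \<noteq> 0 \<Longrightarrow> supp f \<noteq> {}"
  by (metis (no_types, lifting) expansion sum.empty)

text \<open>The extended ideal \<open>B[X]\<close>.\<close>
definition ext :: "'r set \<Rightarrow> 'r set" where
  "ext B = {f \<in> D. \<forall>t. coef f t \<in> B}"

lemma extD: "f \<in> ext B \<Longrightarrow> f \<in> D" "f \<in> ext B \<Longrightarrow> coef f t \<in> B"
  by (auto simp: ext_def)

lemma ext_mono: "B \<subseteq> C \<Longrightarrow> ext B \<subseteq> ext C"
  by (auto simp: ext_def)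

lemma ext_ideal:
  assumes B: "is_ideal R B"
  shows "is_ideal D (ext B)"
  unfolding is_ideal_def
proof (intro conjI ballI)
  note B' = is_idealD[OF B]
  show "ext B \<subseteq> D" by (auto simp: ext_def)
  show "0 \<in> ext B" using B' D_closed by (auto simp: ext_def)
  show "x - y \<in> ext B" if "x \<in> ext B" "y \<in> ext B" for x y
    using that B' D_closed(3) by (auto simp: ext_def coef_diff)
  show "g * f \<in> ext B" if g: "g \<in> D" and f: "f \<in> ext B" for g f
  proof -
    have f': "f \<in> D" "\<And>t. coef f t \<in> B" using f by (auto simp: ext_def)
    have "coef (g * f) u \<in> B" for u
      unfolding coef_mult[OF g f'(1)]
      by (intro ideal_sum[OF B]) (use f' g B' coef_mem in auto)
    then show ?thesis using D_closed(4)[OF g f'(1)] by (simp add: ext_def)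
  qed
qed

lemma const_mem_ext_iff: "is_ideal R B \<Longrightarrow> r \<in> R \<Longrightarrow> r \<in> ext B \<longleftrightarrow> r \<in> B"
  using R_in_D[of r] is_idealD(2)[of R B] by (auto simp: ext_def coef_const)

lemma monomial_mem_ext:
  assumes "is_ideal R B" "r \<in> B" "t \<in> T"
  shows "r * mon t \<in> ext B"
proof -
  have "r \<in> R" using is_idealD(1)[OF assms(1)] assms(2) by auto
  then show ?thesis
    using assms is_idealD(2)[OF assms(1)] monomial_mem[of r t] by (auto simp: ext_def coef_monomial)
qed

text \<open>A form of McCoy's theorem on zero divisors: read modulo \<open>B\<close>, it says that if \<open>f h = 0\<close> with
  \<open>h \<noteq> 0\<close> then some nonzero scalar multiple of \<open>h\<close> is killed by every coefficient of \<open>f\<close>.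
  The product of the coefficients at a pair of monomials whose product arises only once vanishes.
  Either that coefficient of \<open>f\<close> kills \<open>h\<close>, and its term can be dropped from \<open>f\<close>; or multiplying
  \<open>h\<close> by it leaves a nonzero polynomial with fewer terms.\<close>
lemma mccoy:
  assumes B: "is_ideal R B"
    and "f \<in> D" "h \<in> D" "f * h \<in> ext B" "h \<notin> ext B"
  shows "\<exists>r\<in>R. r * h \<notin> ext B \<and> (\<forall>t. coef f t * (r * h) \<in> ext B)"
  using assms(2-)
proof (induction "card (supp f) + card (supp h)" arbitrary: f h rule: less_induct)
  case (less f h)
  note E = is_idealD[OF ext_ideal[OF B]]
  note f = \<open>f \<in> D\<close> and h = \<open>h \<in> D\<close>
  note fin = support_finite[OF f] support_finite[OF h]
  show ?case
  proof (cases "supp f = {}")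
    case True
    then show ?thesis
      using less.prems R_closed(2) E(2) by (intro bexI[of _ 1]) auto
  next
    case False
    have "supp h \<noteq> {}"
      using supp_nonempty[OF h] less.prems(4) E(2) by auto
    then obtain m n where mn: "m \<in> supp f" "n \<in> supp h"
      and uniq: "\<And>m' n'. m' \<in> supp f \<Longrightarrow> n' \<in> supp h \<Longrightarrow> m' + n' = m + n \<Longrightarrow> m' = m \<and> n' = n"
      using unique_sum[OF fin False] support_subset[OF f] support_subset[OF h] by blast
    have mT: "m \<in> T" and nT: "n \<in> T" using mn support_subset f h by auto
    let ?a = "coef f m" and ?b = "coef h n"
    have aR: "?a \<in> R" and bR: "?b \<in> R" using coef_mem f h by auto
    have "coef (f * h) (m + n) =
        (\<Sum>s\<in>supp f. \<Sum>t\<in>supp h. if s = m then if t = n then ?a * ?b else 0 else 0)"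
      unfolding coef_mult[OF f h] using uniq by (intro sum.cong refl) auto
    also have "\<dots> = (\<Sum>s\<in>supp f. if s = m then \<Sum>t\<in>supp h. if t = n then ?a * ?b else 0 else 0)"
      by (intro sum.cong refl) auto
    also have "\<dots> = ?a * ?b"
      using mn fin by (simp add: sum.delta)
    finally have ab: "?a * ?b \<in> B" using extD(2)[OF less.prems(3), of "m + n"] by simp
    show ?thesis
    proof (cases "?a * h \<in> ext B")
      case True
      let ?f = "f - ?a * mon m"
      have amD: "?a * mon m \<in> D" by (rule monomial_mem[OF aR mT])
      have f': "?f \<in> D" by (rule D_closed(3)[OF f amD])
      have cf: "coef ?f t = (if t = m then 0 else coef f t)" for t
        by (simp add: coef_diff[OF f amD] coef_monomial[OF aR mT])
      have "supp ?f = supp f - {m}" by (auto simp: cf)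
      then have "card (supp ?f) < card (supp f)" using mn(1) fin(1) by (metis card_Diff1_less)
      moreover have "?f * h \<in> ext B"
        using E(3)[OF less.prems(3) E(4)[OF mon_mem[OF mT] True]]
        by (simp add: left_diff_distrib mult.left_commute mult.assoc)
      ultimately obtain r where r: "r \<in> R" "r * h \<notin> ext B" "\<And>t. coef ?f t * (r * h) \<in> ext B"
        using less.hyps[OF add_strict_right_mono f' h _ less.prems(4)] by blast
      have "coef f t * (r * h) \<in> ext B" for t
      proof (cases "t = m")
        case True
        then show ?thesis
          using E(4)[OF R_in_D[OF r(1)] \<open>?a * h \<in> ext B\<close>] by (simp add: mult.left_commute)
      next
        case False
        then show ?thesis using r(3)[of t] by (simp add: cf)
      qed
      then show ?thesis using r by blast
    next
      case False
      let ?h = "?a * h - (?a * ?b) * mon n"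
      have ahD: "?a * h \<in> D" by (rule D_closed(4)[OF R_in_D[OF aR] h])
      have abn: "(?a * ?b) * mon n \<in> ext B" by (rule monomial_mem_ext[OF B ab nT])
      have h': "?h \<in> D" by (rule D_closed(3)[OF ahD extD(1)[OF abn]])
      have ch: "coef ?h t = (if t = n then 0 else ?a * coef h t)" for t
        by (simp add: coef_diff[OF ahD extD(1)[OF abn]] coef_scale[OF aR h]
            coef_monomial[OF R_closed(4)[OF aR bR] nT])
      have "supp ?h \<subseteq> supp h - {n}" by (auto simp: ch)
      then have "card (supp ?h) < card (supp h)"
        using mn(2) fin(2) by (meson card_Diff1_less card_mono finite_Diff le_less_trans)
      moreover have "?h \<notin> ext B"
      proof
        assume "?h \<in> ext B"
        then have "?h + (?a * ?b) * mon n \<in> ext B" by (rule E(5)[OF _ abn])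
        then show False using False by simp
      qed
      moreover have "f * ?h \<in> ext B"
        using E(3)[OF E(4)[OF R_in_D[OF aR] less.prems(3)] E(4)[OF f abn]]
        by (simp add: right_diff_distrib mult.left_commute)
      ultimately obtain r where r: "r \<in> R" "r * ?h \<notin> ext B" "\<And>t. coef f t * (r * ?h) \<in> ext B"
        using less.hyps[OF add_strict_left_mono f h'] by blast
      have rabn: "r * ((?a * ?b) * mon n) \<in> ext B" by (rule E(4)[OF R_in_D[OF r(1)] abn])
      have eq: "(r * ?a) * h = r * ?h + r * ((?a * ?b) * mon n)"
        by (simp add: right_diff_distrib mult.assoc)
      have "(r * ?a) * h \<notin> ext B"
      proof
        assume "(r * ?a) * h \<in> ext B"
        then have "(r * ?a) * h - r * ((?a * ?b) * mon n) \<in> ext B" by (rule E(3)[OF _ rabn])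
        then show False using r(2) unfolding eq by simp
      qed
      moreover have "coef f t * ((r * ?a) * h) \<in> ext B" for t
        unfolding eq distrib_left[of "coef f t"]
        by (rule E(5)[OF r(3) E(4)[OF R_in_D[OF coef_mem[OF f]] rabn]])
      ultimately show ?thesis using R_closed(4)[OF r(1) aR] by blast
    qed
  qed
qed

text \<open>Scaling \<open>h\<close> further keeps what has been achieved, so the polynomials in \<open>G\<close> can be treated in turn.\<close>
lemma mccoy_finite:
  assumes B: "is_ideal R B" and "finite G" "G \<subseteq> D" "h \<in> D" "h \<notin> ext B"
    and "\<And>f. f \<in> G \<Longrightarrow> f * h \<in> ext B"
  shows "\<exists>r\<in>R. r * h \<notin> ext B \<and> (\<forall>f\<in>G. \<forall>t. coef f t * (r * h) \<in> ext B)"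
  using assms(2,3,6)
proof (induction G rule: finite_induct)
  case empty
  then show ?case using assms R_closed(2) by (intro bexI[of _ 1]) auto
next
  case (insert f G)
  note E = is_idealD[OF ext_ideal[OF B]]
  obtain r where r: "r \<in> R" "r * h \<notin> ext B" "\<And>g t. g \<in> G \<Longrightarrow> coef g t * (r * h) \<in> ext B"
    using insert by auto
  have "f * (r * h) \<in> ext B"
    using E(4)[OF R_in_D[OF r(1)], of "f * h"] insert.prems(2)[of f] by (simp add: mult.left_commute)
  then obtain q where q: "q \<in> R" "q * (r * h) \<notin> ext B" "\<And>t. coef f t * (q * (r * h)) \<in> ext B"
    using mccoy[OF B, of f "r * h"] r(1,2) insert.prems(1) D_closed(4)[OF R_in_D[OF r(1)] assms(4)]
    by auto
  have "coef g t * (q * (r * h)) \<in> ext B" if "g \<in> G" for g t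
    using E(4)[OF R_in_D[OF q(1)] r(3)[OF that]] by (simp add: mult.left_commute)
  then have "(q * r) * h \<notin> ext B \<and> (\<forall>g\<in>insert f G. \<forall>t. coef g t * ((q * r) * h) \<in> ext B)"
    using q by (simp add: mult.assoc)
  then show ?case using R_closed(4)[OF q(1) r(1)] by blast
qed

lemma multiples_ideal:
  assumes "b \<in> R"
  shows "is_ideal R {x. divides_in R b x}"
  unfolding is_ideal_def
proof (intro conjI ballI)
  show "{x. divides_in R b x} \<subseteq> R" using R_closed(4)[OF assms] by (auto simp: divides_in_def)
  show "0 \<in> {x. divides_in R b x}" using R_closed(1) by (auto simp: divides_in_def intro: bexI[of _ 0])
  show "x - y \<in> {x. divides_in R b x}" if "x \<in> {x. divides_in R b x}" "y \<in> {x. divides_in R b x}" for x y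
    using that R_closed(3) by (auto simp: divides_in_def right_diff_distrib[symmetric])
  show "r * x \<in> {x. divides_in R b x}" if "r \<in> R" "x \<in> {x. divides_in R b x}" for r x
    using that divides_in_mult[OF subdomain_R] by auto
qed

text \<open>Divisibility by constants is checked on coefficients; this makes \<open>v\<close>-hulls in \<open>R\<close> and \<open>D\<close> comparable.\<close>
lemma divides_in_iff_coef:
  assumes b: "b \<in> R" and f: "f \<in> D"
  shows "divides_in D b f \<longleftrightarrow> (\<forall>t. divides_in R b (coef f t))"
proof
  assume "divides_in D b f"
  then obtain g where "g \<in> D" "f = b * g" by (auto simp: divides_in_def)
  then show "\<forall>t. divides_in R b (coef f t)"
    using coef_mem[of g] by (auto simp: divides_in_def coef_scale[OF b])
next
  assume "\<forall>t. divides_in R b (coef f t)"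
  then obtain q where q: "\<And>t. q t \<in> R" "\<And>t. coef f t = b * q t"
    unfolding divides_in_def by metis
  have "f = (\<Sum>t\<in>supp f. b * q t * mon t)"
    using expansion[OF f] q(2) by simp
  also have "\<dots> = b * (\<Sum>t\<in>supp f. q t * mon t)"
    by (simp add: sum_distrib_left mult.assoc)
  finally have "f = b * (\<Sum>t\<in>supp f. q t * mon t)" .
  moreover have "(\<Sum>t\<in>supp f. q t * mon t) \<in> D"
    using q(1) f by (intro subdomain_sum[OF subdomain_D] monomial_mem) (auto intro: support_subset)
  ultimately show "divides_in D b f" unfolding divides_in_def by blast
qed

lemma mem_ext_multiples_iff:
  "b \<in> R \<Longrightarrow> f \<in> D \<Longrightarrow> f \<in> ext {x. divides_in R b x} \<longleftrightarrow> divides_in D b f"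
  by (simp add: ext_def divides_in_iff_coef)

text \<open>If \<open>a / b\<close> is a fraction of \<open>R\<close> carrying all coefficients of \<open>J\<close> into \<open>R\<close>, then it carries \<open>J\<close> into \<open>D\<close>, hence
  also every \<open>x \<in> J\<^sub>v\<close>, and therefore the coefficients of \<open>x\<close> into \<open>R\<close>. So these lie in the \<open>v\<close>-hull of the
  coefficients of \<open>J\<close>.\<close>
lemma t_closed_ext:
  assumes N: "t_closed R N"
  shows "t_closed D (ext N)"
  unfolding t_closed_def
proof (intro conjI allI impI)
  note Ni = t_closed_is_ideal[OF subdomain_R N]
  show "ext N \<subseteq> D" by (auto simp: ext_def)
  obtain n where "n \<in> N" "n \<noteq> 0" using N by (auto simp: t_closed_def)
  then show "\<exists>x\<in>ext N. x \<noteq> 0"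
    using const_mem_ext_iff[OF Ni] is_idealD(1)[OF Ni] by blast
  fix J assume J: "finite J \<and> J \<subseteq> ext N \<and> (\<exists>j\<in>J. j \<noteq> 0)"
  then have JD: "J \<subseteq> D" by (auto simp: ext_def)
  define C where "C = (\<Union>f\<in>J. coef f ` supp f)"
  have "finite C" using J JD support_finite by (auto simp: C_def)
  moreover have "C \<subseteq> N" using J by (auto simp: C_def ext_def)
  moreover obtain j t where "j \<in> J" "coef j t \<noteq> 0" using J JD supp_nonempty by blast
  then have "coef j t \<in> C" "coef j t \<noteq> 0" by (auto simp: C_def)
  ultimately have CN: "v_hull R C \<subseteq> N" by (rule t_closed_v_hull[OF N])
  show "v_hull D J \<subseteq> ext N"
  proof
    fix x assume x: "x \<in> v_hull D J"
    then have xD: "x \<in> D" using v_hull_subset by blast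
    have "coef x u \<in> v_hull R C" for u
    proof (rule v_hullI)
      show "coef x u \<in> R" by (rule coef_mem[OF xD])
      fix a b assume ab: "a \<in> R" "b \<in> R" "b \<noteq> 0" "\<And>c. c \<in> C \<Longrightarrow> divides_in R b (a * c)"
      have "divides_in D b (a * f)" if "f \<in> J" for f
      proof -
        have fD: "f \<in> D" using that JD by auto
        have "divides_in R b (a * coef f t)" for t
        proof (cases "coef f t = 0")
          case True
          then show ?thesis using R_closed(1) by (auto simp: divides_in_def intro: bexI[of _ 0])
        next
          case False
          then show ?thesis using that by (intro ab(4)) (auto simp: C_def)
        qed
        then show ?thesis
          using divides_in_iff_coef[OF ab(2) D_closed(4)[OF R_in_D[OF ab(1)] fD]]
          by (simp add: coef_scale[OF ab(1) fD])
      qed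
      then have "divides_in D b (a * x)"
        using v_hullD[OF x R_in_D[OF ab(1)] R_in_D[OF ab(2)] ab(3)] by blast
      then show "divides_in R b (a * coef x u)"
        using divides_in_iff_coef[OF ab(2) D_closed(4)[OF R_in_D[OF ab(1)] xD]]
        by (simp add: coef_scale[OF ab(1) xD])
    qed
    then show "x \<in> ext N" using CN xD by (auto simp: ext_def)
  qed
qed

section \<open>Maximal \<open>t\<close>-ideals of the extension\<close>

definition coeffs_of :: "'r set \<Rightarrow> 'r set" where
  "coeffs_of Q = (\<Union>f\<in>Q. range (coef f))"

lemma coeffs_of_props:
  assumes Q: "t_closed D Q"
  shows "coeffs_of Q \<subseteq> R" "\<exists>s\<in>coeffs_of Q. s \<noteq> 0"
proof -
  have QD: "Q \<subseteq> D" using Q by (simp add: t_closed_def)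
  then show "coeffs_of Q \<subseteq> R" using coef_mem by (auto simp: coeffs_of_def)
  obtain f where "f \<in> Q" "f \<noteq> 0" using Q by (auto simp: t_closed_def)
  then obtain t where "coef f t \<noteq> 0" using supp_nonempty QD by blast
  then show "\<exists>s\<in>coeffs_of Q. s \<noteq> 0" using \<open>f \<in> Q\<close> by (auto simp: coeffs_of_def)
qed

text \<open>Let \<open>N\<close> be the \<open>t\<close>-hull of the coefficients of \<open>Q\<close>. Then \<open>N[X]\<close> is a proper \<open>t\<close>-ideal containing \<open>Q\<close>, hence
  equal to \<open>Q\<close>; and a proper \<open>t\<close>-ideal of \<open>R\<close> above \<open>N\<close> would extend to one of \<open>D\<close> above \<open>Q\<close>.\<close>
lemma extended_if_proper_content:
  assumes Q: "Q \<in> t_maximal D" and proper: "1 \<notin> t_hull R (coeffs_of Q)"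
  shows "Q \<inter> R \<in> t_maximal R" "Q = ext (Q \<inter> R)"
proof -
  note tQ = t_maximalD(1)[OF Q]
  note C = coeffs_of_props[OF tQ]
  obtain s where s: "s \<in> coeffs_of Q" "s \<noteq> 0" using C(2) by blast
  define N where "N = t_hull R (coeffs_of Q)"
  have tN: "t_closed R N" unfolding N_def by (rule t_closed_t_hull[OF C(1) s])
  have CN: "coeffs_of Q \<subseteq> N" unfolding N_def by (rule t_hull_extensive[OF C(1) s])
  have one: "1 \<notin> ext N'" if "t_closed R N'" "1 \<notin> N'" for N'
    using const_mem_ext_iff[OF t_closed_is_ideal[OF subdomain_R that(1)] R_closed(2)] that(2) by simp
  have contr: "ext N' \<inter> R = N'" if "t_closed R N'" for N'
    using const_mem_ext_iff[OF t_closed_is_ideal[OF subdomain_R that]] that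
    by (auto simp: t_closed_def)
  have "Q \<subseteq> ext N"
  proof
    fix f assume "f \<in> Q"
    then show "f \<in> ext N"
      using CN t_closed_ideal(1)[OF subdomain_D tQ] by (auto simp: ext_def coeffs_of_def)
  qed
  then have QN: "ext N = Q"
    using t_maximalD(3)[OF Q t_closed_ext[OF tN]] one[OF tN] proper by (simp add: N_def)
  then have N: "Q \<inter> R = N" using contr[OF tN] by simp
  then show "Q = ext (Q \<inter> R)" using QN by simp
  show "Q \<inter> R \<in> t_maximal R"
    unfolding N t_maximal_def
  proof (intro CollectI conjI allI impI)
    show "t_closed R N" by (rule tN)
    show "1 \<notin> N" using proper by (simp add: N_def)
    fix N' assume N': "t_closed R N' \<and> 1 \<notin> N' \<and> N \<subseteq> N'"
    then have "ext N' = Q"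
      using t_maximalD(3)[OF Q t_closed_ext one] ext_mono[of N N'] QN by blast
    then show "N' = N" using contr[of N'] N' N by simp
  qed
qed

lemma finite_coefficient_witness:
  assumes "finite J" "J \<subseteq> coeffs_of Q"
  obtains G where "finite G" "G \<subseteq> Q" "J \<subseteq> coeffs_of G"
proof -
  have "\<forall>j\<in>J. \<exists>f\<in>Q. j \<in> range (coef f)"
    using assms(2) unfolding coeffs_of_def by blast
  then obtain g where g: "\<forall>j\<in>J. g j \<in> Q \<and> j \<in> range (coef (g j))" by metis
  show ?thesis
    by (rule that[of "g ` J"]) (use g assms(1) in \<open>auto simp: coeffs_of_def\<close>)
qed

text \<open>Otherwise finitely many \<open>f \<in> G \<subseteq> Q\<close> have coefficients with \<open>v\<close>-hull \<open>R\<close>. A fraction \<open>a / b\<close> carrying \<open>c\<close> and \<open>G\<close>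
  into \<open>D\<close> can be written \<open>h / c\<close> with \<open>h \<in> D\<close>, and \<open>c\<close> divides each \<open>f h\<close>. If \<open>c\<close> did not divide \<open>h\<close>,
  McCoy's theorem modulo \<open>cR\<close> would provide \<open>y \<in> R\<close> not divisible by \<open>c\<close> such that \<open>c\<close> divides \<open>y\<close> times each of these
  coefficients, hence \<open>y\<close> itself. So \<open>a / b \<in> D\<close>, which proves \<open>1 \<in> (G \<union> {c})\<^sub>v \<subseteq> Q\<close>.\<close>
lemma proper_content_if_meets_R:
  assumes Q: "Q \<in> t_maximal D" and c: "c \<in> Q" "c \<in> R" "c \<noteq> 0"
  shows "1 \<notin> t_hull R (coeffs_of Q)"
proof
  note tQ = t_maximalD(1)[OF Q]
  note QD = t_closed_ideal(1)[OF subdomain_D tQ]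
  assume "1 \<in> t_hull R (coeffs_of Q)"
  then obtain J j where J: "finite J" "J \<subseteq> coeffs_of Q" "j \<in> J" "j \<noteq> 0" "1 \<in> v_hull R J"
    by (rule t_hullE)
  obtain G where G: "finite G" "G \<subseteq> Q" "J \<subseteq> coeffs_of G"
    using finite_coefficient_witness[OF J(1,2)] .
  let ?M = "{x. divides_in R c x}"
  have M: "is_ideal R ?M" by (rule multiples_ideal[OF c(2)])
  have GD: "G \<subseteq> D" using G(2) QD by auto
  have "1 \<in> v_hull D (insert c G)"
  proof (rule v_hullI)
    show "1 \<in> D" by (rule D_closed(2))
    fix a b
    assume ab: "a \<in> D" "b \<in> D" "b \<noteq> 0" "\<And>f. f \<in> insert c G \<Longrightarrow> divides_in D b (a * f)"
    obtain h where h: "h \<in> D" "a * c = b * h" using ab(4)[of c] by (auto simp: divides_in_def)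
    have fh: "f * h \<in> ext ?M" if "f \<in> G" for f
    proof -
      have "divides_in D b (a * f)" using that by (intro ab(4)) simp
      then obtain k where k: "k \<in> D" "a * f = b * k" by (auto simp: divides_in_def)
      have "b * (f * h) = f * (b * h)" by (simp add: mult.left_commute)
      also have "\<dots> = c * (a * f)" using h(2)[symmetric] by (simp add: mult_ac)
      also have "\<dots> = b * (c * k)" using k(2) by (simp add: mult.left_commute)
      finally have "f * h = c * k" using ab(3) by simp
      moreover have "f * h \<in> D" using that GD h(1) D_closed(4) by blast
      ultimately show ?thesis using k(1) mem_ext_multiples_iff[OF c(2)] by (auto simp: divides_in_def)
    qed
    have "h \<in> ext ?M"
    proof (rule ccontr)
      assume "h \<notin> ext ?M"
      then obtain r where r: "r \<in> R" "r * h \<notin> ext ?M" "\<And>f t. f \<in> G \<Longrightarrow> coef f t * (r * h) \<in> ext ?M"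
        using mccoy_finite[OF M G(1) GD h(1) _ fh] by blast
      have rh: "r * h \<in> D" using D_closed(4)[OF R_in_D[OF r(1)] h(1)] .
      then obtain u where u: "\<not> divides_in R c (coef (r * h) u)" using r(2) by (auto simp: ext_def)
      have "divides_in R c (coef (r * h) u * j)" if "j \<in> J" for j
      proof -
        have "j \<in> coeffs_of G" using that G(3) by blast
        then obtain f t where ft: "f \<in> G" "j = coef f t" unfolding coeffs_of_def by blast
        have "f \<in> D" using ft(1) GD by blast
        have "coef (coef f t * (r * h)) u = coef f t * coef (r * h) u"
          by (rule coef_scale[OF coef_mem[OF \<open>f \<in> D\<close>] rh])
        then show ?thesis
          using extD(2)[OF r(3)[OF ft(1)], of t u] ft(2) by (simp add: mult.commute)
      qed
      then have "divides_in R c (coef (r * h) u * 1)"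
        using v_hullD[OF J(5) coef_mem[OF rh] c(2,3)] by blast
      then show False using u by simp
    qed
    then obtain k where k: "k \<in> D" "h = c * k"
      using mem_ext_multiples_iff[OF c(2) h(1)] by (auto simp: divides_in_def)
    then have "a * c = (b * k) * c" using h(2) by (simp add: mult_ac)
    then have "a = b * k" by (rule mult_right_cancel[OF c(3), THEN iffD1])
    then show "divides_in D b (a * 1)" using k(1) by (auto simp: divides_in_def)
  qed
  moreover have "v_hull D (insert c G) \<subseteq> Q"
    by (rule t_closed_v_hull[OF tQ, of _ c]) (use G c in auto)
  ultimately show False using t_maximalD(2)[OF Q] by blast
qed

lemma t_maximal_extended:
  assumes Q: "Q \<in> t_maximal D" and c: "c \<in> Q" "c \<in> R" "c \<noteq> 0"
  shows "Q \<inter> R \<in> t_maximal R" "Q = ext (Q \<inter> R)"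
  by (rule extended_if_proper_content[OF Q proper_content_if_meets_R[OF Q c]])+

text \<open>A fraction \<open>a / b\<close> of \<open>R\<close> isolating \<open>Q \<inter> R\<close> also isolates \<open>Q\<close>. If \<open>N\<close> meets \<open>R\<close> in \<open>0\<close>, the denominator
  \<open>b\<close> itself lies outside \<open>N\<close>; otherwise \<open>N\<close> is extended from a maximal \<open>t\<close>-ideal of \<open>R\<close> other than \<open>Q \<inter> R\<close>.\<close>
lemma isolated_if_meets_R:
  assumes iso: "\<forall>P\<in>t_maximal R. isolated R P"
    and Q: "Q \<in> t_maximal D" and c: "c \<in> Q" "c \<in> R" "c \<noteq> 0"
  shows "isolated D Q"
proof -
  define P where "P = Q \<inter> R"
  have P: "P \<in> t_maximal R" "Q = ext P" unfolding P_def by (rule t_maximal_extended[OF Q c])+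
  have "isolated R P" using iso P(1) by blast
  then obtain a b where "a \<in> R" "b \<in> R - {0}"
    and ab': "\<forall>s\<in>R - P. \<not> divides_in R b (a * s)"
      "\<forall>N\<in>t_maximal R - {P}. \<exists>s\<in>R - N. divides_in R b (a * s)"
    unfolding isolated_def by blast
  then have ab: "a \<in> R" "b \<in> R" "b \<noteq> 0"
    "\<And>s. s \<in> R - P \<Longrightarrow> \<not> divides_in R b (a * s)"
    "\<And>N. N \<in> t_maximal R - {P} \<Longrightarrow> \<exists>s\<in>R - N. divides_in R b (a * s)"
    by blast+
  have up: "divides_in D b x" if "divides_in R b x" for x
    using that R_subset by (auto simp: divides_in_def)
  show ?thesis
    unfolding isolated_def
  proof (rule bexI[OF _ R_in_D[OF ab(1)]], rule bexI[of _ b], intro conjI ballI)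
    show "b \<in> D - {0}" using ab R_in_D by auto
    show "\<not> divides_in D b (a * s)" if s: "s \<in> D - Q" for s
    proof
      assume "divides_in D b (a * s)"
      then have "divides_in R b (a * coef s t)" for t
        using divides_in_iff_coef[OF ab(2) D_closed(4)[OF R_in_D[OF ab(1)], of s]] s
        by (simp add: coef_scale[OF ab(1)])
      moreover have "coef s t \<in> R" for t using coef_mem s by blast
      ultimately have "coef s t \<in> P" for t using ab(4)[of "coef s t"] by blast
      then have "s \<in> ext P" using s by (simp add: ext_def)
      then show False using s P(2) by blast
    qed
    show "\<exists>s\<in>D - N. divides_in D b (a * s)" if N: "N \<in> t_maximal D - {Q}" for N
    proof (cases "\<exists>d\<in>N \<inter> R. d \<noteq> 0")
      case True
      then obtain d where d: "d \<in> N" "d \<in> R" "d \<noteq> 0" by blast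
      have N1: "N \<in> t_maximal D" using N by blast
      note N' = t_maximal_extended[OF N1 d]
      have "N \<inter> R \<noteq> P" 
      proof
        assume "N \<inter> R = P"
        then have "ext (N \<inter> R) = Q" using P(2) by simp
        with N'(2) have "N = Q" by (rule trans)
        then show False using N by blast
      qed
      then obtain s where "s \<in> R - N \<inter> R" "divides_in R b (a * s)"
        using ab(5)[of "N \<inter> R"] N'(1) by blast
      then have "s \<in> D - N" "divides_in D b (a * s)" using up R_in_D by auto
      then show ?thesis by blast
    next
      case False
      then have "b \<in> D - N" using ab(2,3) R_in_D by auto
      moreover have "divides_in D b (a * b)"
        using R_in_D[OF ab(1)] by (auto simp: divides_in_def mult.commute)
      ultimately show ?thesis by blast
    qed
  qed
qed

end

section \<open>One indeterminate\<close>

text \<open>Polynomials in one indeterminate: a monomial is determined by its degree, and it divides every monomial of at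
  least the same degree.\<close>
locale univariate_basis = monomial_basis R D T mon coef
  for R D :: "'r::idom set" and T :: "'t::comm_monoid_add set"
    and mon :: "'t \<Rightarrow> 'r" and coef :: "'r \<Rightarrow> 't \<Rightarrow> 'r" +
  fixes deg :: "'t \<Rightarrow> nat"
  assumes deg_inj: "inj_on deg T"
    and deg_add: "deg (s + t) = deg s + deg t"
    and deg_le: "s \<in> T \<Longrightarrow> t \<in> T \<Longrightarrow> deg s \<le> deg t \<Longrightarrow> \<exists>u\<in>T. t = s + u"
begin

lemma deg_zero: "deg 0 = 0"
  using deg_add[of 0 0] by simp

lemma deg_eqD: "s \<in> T \<Longrightarrow> t \<in> T \<Longrightarrow> deg s = deg t \<Longrightarrow> s = t"
  using deg_inj by (auto simp: inj_on_def)

lemma coef_monomial_mult: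
  assumes "r \<in> R" "u \<in> T" "p \<in> D"
  shows "coef (r * mon u * p) w = (\<Sum>t\<in>supp p. if u + t = w then r * coef p t else 0)"
proof -
  have "coef (r * mon u * p) w =
      (\<Sum>s\<in>supp (r * mon u). \<Sum>t\<in>supp p. if s + t = w then coef (r * mon u) s * coef p t else 0)"
    by (rule coef_mult[OF monomial_mem[OF assms(1,2)] assms(3)])
  also have "\<dots> = (\<Sum>s\<in>{u}. \<Sum>t\<in>supp p. if s + t = w then coef (r * mon u) s * coef p t else 0)"
    by (rule sum.mono_neutral_left)
      (use assms(1,2) in \<open>auto simp: coef_monomial split: if_splits intro!: sum.neutral\<close>)
  finally show ?thesis
    using coef_monomial[OF assms(1,2), of u] by (simp cong: if_cong)
qed

text \<open>Multiplying \<open>g\<close> by the leading coefficient of \<open>p\<close> makes its leading term divisible by that of \<open>p\<close>. The bound on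
  \<open>q\<close> is what makes the induction in \<open>finite_uppers_to_zero\<close> progress.\<close>
lemma pseudo_division:
  assumes p: "p \<in> D" and d: "coef p d \<noteq> 0" "\<And>t. coef p t \<noteq> 0 \<Longrightarrow> deg t \<le> deg d"
    and "g \<in> D" "\<And>t. coef g t \<noteq> 0 \<Longrightarrow> deg t < n"
  shows "\<exists>k. \<exists>q\<in>D. (\<forall>t. coef q t \<noteq> 0 \<longrightarrow> deg t + deg d < n) \<and>
    (\<forall>t. coef (coef p d ^ k * g - p * q) t \<noteq> 0 \<longrightarrow> deg t < deg d)"
  using assms(4,5)
proof (induction n arbitrary: g)
  case 0
  then show ?case
    by (intro exI[of _ 0] bexI[of _ 0]) (auto intro: D_closed)
next
  case (Suc n)
  let ?c = "coef p d"
  have c: "?c \<in> R" by (rule coef_mem[OF p])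
  have dT: "d \<in> T" by (rule support_subset[OF p d(1)])
  note g = \<open>g \<in> D\<close>
  \<comment> \<open>Only when \<open>g\<close> has a term of degree exactly \<open>n \<ge> deg d\<close> is there something to cancel.\<close>
  consider "n < deg d" | "\<And>t. coef g t \<noteq> 0 \<Longrightarrow> deg t < n"
    | t0 where "deg d \<le> n" "coef g t0 \<noteq> 0" "deg t0 = n"
    using Suc.prems(2) by (metis less_antisym linorder_not_less)
  then show ?case
  proof cases
    case 1
    then have "\<forall>t. coef (?c ^ 0 * g - p * 0) t \<noteq> 0 \<longrightarrow> deg t < deg d"
      using Suc.prems(2) by fastforce
    then show ?thesis
      using D_closed(1) by (intro exI[of _ 0] bexI[of _ 0]) auto
  next
    case 2
    then show ?thesis using Suc.IH[OF g] by (meson less_SucI)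
  next
    case 3
    have t0T: "t0 \<in> T" by (rule support_subset[OF g 3(2)])
    obtain u where u: "u \<in> T" "t0 = d + u" using deg_le[OF dT t0T] 3 by auto
    let ?b = "coef g t0"
    have b: "?b \<in> R" by (rule coef_mem[OF g])
    let ?m = "?b * mon u"
    have m: "?m \<in> D" by (rule monomial_mem[OF b u(1)])
    let ?g = "?c * g - ?m * p"
    have cg: "?c * g \<in> D" by (rule D_closed(4)[OF R_in_D[OF c] g])
    have g': "?g \<in> D" by (rule D_closed(3)[OF cg D_closed(4)[OF m p]])
    have cf: "coef ?g w = ?c * coef g w - coef (?m * p) w" for w
      by (simp only: coef_diff[OF cg D_closed(4)[OF m p]] coef_scale[OF c g])
    have mp: "deg w \<le> n" if "coef (?m * p) w \<noteq> 0" for w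
    proof -
      have "\<exists>t\<in>supp p. u + t = w"
      proof (rule ccontr)
        assume "\<not> ?thesis"
        then have "coef (?m * p) w = 0"
          unfolding coef_monomial_mult[OF b u(1) p] by (intro sum.neutral) auto
        then show False using that by simp
      qed
      then obtain t where "coef p t \<noteq> 0" "u + t = w" by auto
      then have "deg w = deg u + deg t" "deg t \<le> deg d" using d(2) deg_add by auto
      then show ?thesis using 3(3) deg_add[of d u] unfolding u(2) by linarith
    qed
    have top: "coef (?m * p) t0 = ?b * ?c"
    proof -
      have "u + t = t0 \<longleftrightarrow> t = d" if "t \<in> supp p" for t
      proof
        assume "u + t = t0"
        then have "deg t = deg d" using u(2) deg_add[of u t] deg_add[of d u] by simp
        then show "t = d" using deg_eqD support_subset[OF p] that dT by blast
      qed (simp add: u(2) add.commute)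
      then have "coef (?m * p) t0 = (\<Sum>t\<in>supp p. if t = d then ?b * coef p t else 0)"
        unfolding coef_monomial_mult[OF b u(1) p] by (intro sum.cong) auto
      also have "\<dots> = ?b * ?c" using support_finite[OF p] d(1) by (simp add: sum.delta)
      finally show ?thesis .
    qed
    have "deg w < n" if w: "coef ?g w \<noteq> 0" for w
    proof -
      have wT: "w \<in> T" by (rule support_subset[OF g' w])
      have "coef g w \<noteq> 0 \<or> coef (?m * p) w \<noteq> 0" using w unfolding cf by auto
      then have "deg w \<le> n" using mp Suc.prems(2)[of w] by auto
      moreover have "deg w \<noteq> n"
      proof
        assume "deg w = n"
        then have "w = t0" using deg_eqD[OF wT t0T] 3(3) by simp
        then show False using w top unfolding cf by (simp add: mult.commute)
      qed
      ultimately show ?thesis by simp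
    qed
    then obtain k q where q: "q \<in> D" "\<And>t. coef q t \<noteq> 0 \<Longrightarrow> deg t + deg d < n"
      "\<And>t. coef (?c ^ k * ?g - p * q) t \<noteq> 0 \<Longrightarrow> deg t < deg d"
      using Suc.IH[OF g'] by blast
    let ?q = "(?c ^ k * ?b) * mon u + q"
    have ckb: "?c ^ k * ?b \<in> R" by (rule R_closed(4)[OF R_closed(7)[OF c] b])
    have ckbm: "(?c ^ k * ?b) * mon u \<in> D" by (rule monomial_mem[OF ckb u(1)])
    have eq: "?c ^ Suc k * g - p * ?q = ?c ^ k * ?g - p * q"
      by (simp add: algebra_simps)
    show ?thesis
    proof (intro exI[of _ "Suc k"] bexI[of _ ?q] conjI allI impI)
      show "?q \<in> D" by (rule D_closed(6)[OF ckbm q(1)])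
      show "deg t < deg d" if "coef (?c ^ Suc k * g - p * ?q) t \<noteq> 0" for t
        using that q(3) unfolding eq by blast
      show "deg t + deg d < Suc n" if "coef ?q t \<noteq> 0" for t
      proof (cases "t = u")
        case True
        then show ?thesis using 3(3) u(2) deg_add[of d u] by simp
      next
        case False
        then have "coef ?q t = coef q t"
          by (simp add: coef_add[OF ckbm q(1)] coef_monomial[OF ckb u(1)])
        then show ?thesis using q(2)[of t] that by simp
      qed
    qed
  qed
qed

text \<open>Over the quotient field of \<open>R\<close>, such a \<open>p\<close> generates the extension of \<open>N\<close>.\<close>
lemma minimal_degree_element:
  assumes N: "N \<in> t_maximal D" and NR: "N \<inter> R \<subseteq> {0}"
  obtains p d where "p \<in> N" "coef p d \<noteq> 0" "0 < deg d" "\<And>t. coef p t \<noteq> 0 \<Longrightarrow> deg t \<le> deg d"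
    "\<And>r. r \<in> N \<Longrightarrow> (\<And>t. coef r t \<noteq> 0 \<Longrightarrow> deg t < deg d) \<Longrightarrow> r = 0"
proof -
  note tN = t_maximalD(1)[OF N]
  note ND = t_closed_ideal(1)[OF subdomain_D tN]
  define pdeg where "pdeg f = Max (deg ` supp f)" for f
  have top: "\<exists>d\<in>supp f. deg d = pdeg f \<and> (\<forall>t\<in>supp f. deg t \<le> deg d)"
    if "f \<in> N" "f \<noteq> 0" for f
  proof -
    have f: "finite (deg ` supp f)" "deg ` supp f \<noteq> {}"
      using support_finite supp_nonempty[of f] that ND by auto
    then have "pdeg f \<in> deg ` supp f" unfolding pdeg_def by (rule Max_in)
    then obtain d where d: "d \<in> supp f" "deg d = pdeg f" by auto
    have "\<forall>t\<in>supp f. deg t \<le> deg d" unfolding d(2) unfolding pdeg_def using f(1) by auto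
    then show ?thesis using d by blast
  qed
  obtain f where "f \<in> N \<and> f \<noteq> 0" using tN by (auto simp: t_closed_def)
  then obtain p where p: "p \<in> N" "p \<noteq> 0" "\<And>f. f \<in> N \<Longrightarrow> f \<noteq> 0 \<Longrightarrow> pdeg p \<le> pdeg f"
    using ex_has_least_nat[of "\<lambda>f. f \<in> N \<and> f \<noteq> 0" f pdeg] by blast
  obtain d where d: "d \<in> supp p" "deg d = pdeg p" "\<And>t. t \<in> supp p \<Longrightarrow> deg t \<le> deg d"
    using top[OF p(1,2)] by blast
  have pD: "p \<in> D" using p(1) ND by auto
  have pos: "0 < deg d"
  proof (rule ccontr)
    assume "\<not> 0 < deg d"
    then have "t = 0" if "t \<in> supp p" for t
      using d(3)[OF that] deg_zero deg_eqD[of t 0] support_subset[OF pD] that exp_zero by auto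
    then have "supp p = {0}" using d(1) by blast
    then have "p = coef p 0" using expansion[OF pD] by (simp add: mon_zero)
    then have "p \<in> R" using coef_mem[OF pD] by metis
    then show False using p(1,2) NR by blast
  qed
  show ?thesis
  proof (rule that[OF p(1) _ pos])
    show "coef p d \<noteq> 0" using d(1) by simp
    show "deg t \<le> deg d" if "coef p t \<noteq> 0" for t using d(3) that by simp
    fix r assume r: "r \<in> N" "\<And>t. coef r t \<noteq> 0 \<Longrightarrow> deg t < deg d"
    show "r = 0"
    proof (rule ccontr)
      assume r0: "r \<noteq> 0"
      obtain t where "coef r t \<noteq> 0" "deg t = pdeg r" using top[OF r(1) r0] by auto
      then show False using r(2)[of t] p(3)[OF r(1) r0] d(2) by simp
    qed
  qed
qed

text \<open>If \<open>N\<close> is such an ideal and \<open>p\<close> is a nonzero element of least degree in \<open>N\<close>, then every \<open>f \<in> N\<close> satisfies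
  \<open>r f = p q\<close> for some nonzero \<open>r \<in> R\<close>. Hence an ideal of this kind that contains \<open>p\<close> contains \<open>N\<close> and equals it
  by maximality, as all these ideals are prime and contain no nonzero constant. For \<open>f = g\<close>, any other one
  containing \<open>g\<close> must therefore contain \<open>q\<close>, which has smaller degree than \<open>g\<close>.\<close>
lemma finite_uppers_to_zero:
  assumes "g \<in> D" "g \<noteq> 0" "\<And>t. coef g t \<noteq> 0 \<Longrightarrow> deg t < n"
  shows "finite {N \<in> t_maximal D. N \<inter> R \<subseteq> {0} \<and> g \<in> N}"
  using assms
proof (induction n arbitrary: g rule: less_induct)
  case (less n g)
  define Z where "Z g = {N \<in> t_maximal D. N \<inter> R \<subseteq> {0} \<and> g \<in> N}" for g
  show ?case
    unfolding Z_def[symmetric]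
  proof (cases "Z g = {}")
    case True
    then show "finite (Z g)" by simp
  next
    case False
    then obtain N where N: "N \<in> t_maximal D" "N \<inter> R \<subseteq> {0}" "g \<in> N" by (auto simp: Z_def)
    note tN = t_maximalD(1)[OF N(1)]
    note NI = t_closed_ideal[OF subdomain_D tN]
    obtain p d where p: "p \<in> N" and d: "coef p d \<noteq> 0" "0 < deg d"
        "\<And>t. coef p t \<noteq> 0 \<Longrightarrow> deg t \<le> deg d"
      and small: "\<And>r. r \<in> N \<Longrightarrow> (\<And>t. coef r t \<noteq> 0 \<Longrightarrow> deg t < deg d) \<Longrightarrow> r = 0"
      using minimal_degree_element[OF N(1,2)] by metis
    have pD: "p \<in> D" using p NI(1) by auto
    have cR: "coef p d \<in> R" by (rule coef_mem[OF pD])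
    have divide: "\<exists>k. \<exists>q\<in>D. coef p d ^ k * f = p * q \<and> (\<forall>t. coef q t \<noteq> 0 \<longrightarrow> deg t + deg d < m)"
      if f: "f \<in> N" "\<And>t. coef f t \<noteq> 0 \<Longrightarrow> deg t < m" for f m
    proof -
      have fD: "f \<in> D" using f(1) NI(1) by auto
      obtain k q where q: "q \<in> D" "\<forall>t. coef q t \<noteq> 0 \<longrightarrow> deg t + deg d < m"
        "\<And>t. coef (coef p d ^ k * f - p * q) t \<noteq> 0 \<Longrightarrow> deg t < deg d"
        using pseudo_division[OF pD d(1,3) fD f(2)] by blast
      have "coef p d ^ k * f - p * q \<in> N"
        using NI(5)[OF NI(4)[OF R_in_D[OF R_closed(7)[OF cR]] f(1)] NI(4)[OF q(1) p]]
        by (simp add: mult.commute)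
      then have "coef p d ^ k * f - p * q = 0" using q(3) by (rule small)
      then show ?thesis using q(1,2) by auto
    qed
    have cN: "coef p d ^ k \<notin> N'" if "N' \<in> t_maximal D" "N' \<inter> R \<subseteq> {0}" for N' k
      using t_maximal_power[OF subdomain_D that(1) R_in_D[OF cR]] that(2) cR d(1) by blast
    have only: "N' = N" if N': "N' \<in> t_maximal D" "N' \<inter> R \<subseteq> {0}" "p \<in> N'" for N'
    proof -
      note N'I = t_closed_ideal[OF subdomain_D t_maximalD(1)[OF N'(1)]]
      have "f \<in> N'" if f: "f \<in> N" for f
      proof -
        have fD: "f \<in> D" using f NI(1) by auto
        define m where "m = Suc (Max (deg ` supp f))"
        have m: "deg t < m" if "coef f t \<noteq> 0" for t
          using support_finite[OF fD] that by (auto simp: m_def less_Suc_eq_le)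
        obtain k q where "q \<in> D" "coef p d ^ k * f = p * q" using divide[OF f m] by blast
        then have "coef p d ^ k * f \<in> N'" using N'I(4)[of q p] N'(3) by (simp add: mult.commute)
        then show ?thesis
          using t_maximal_prime[OF subdomain_D N'(1) R_in_D[OF R_closed(7)[OF cR]] fD]
            cN[OF N'(1,2)] by blast
      qed
      then show ?thesis
        using t_maximalD(3)[OF N(1) t_maximalD(1,2)[OF N'(1)]] by blast
    qed
    obtain k q where q: "q \<in> D" "coef p d ^ k * g = p * q"
      "\<And>t. coef q t \<noteq> 0 \<Longrightarrow> deg t + deg d < n"
      using divide[OF N(3) less.prems(3)] by blast
    have "coef p d ^ k * g \<noteq> 0" using d(1) less.prems(2) by simp
    then have q0: "q \<noteq> 0" using q(2) by auto
    have n: "n - deg d < n"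
    proof -
      obtain t where "coef g t \<noteq> 0" using supp_nonempty[OF less.prems(1,2)] by auto
      then show ?thesis using less.prems(3)[of t] d(2) by simp
    qed
    have "finite (Z q)"
      unfolding Z_def by (rule less.IH[OF n q(1) q0]) (use q(3) in fastforce)
    moreover have "Z g \<subseteq> insert N (Z q)"
    proof
      fix N' assume "N' \<in> Z g"
      then have N': "N' \<in> t_maximal D" "N' \<inter> R \<subseteq> {0}" "g \<in> N'" by (auto simp: Z_def)
      note N'I = t_closed_ideal[OF subdomain_D t_maximalD(1)[OF N'(1)]]
      have "p * q \<in> N'"
        using N'I(4)[OF R_in_D[OF R_closed(7)[OF cR]] N'(3), of k] q(2) by simp
      then have "p \<in> N' \<or> q \<in> N'"
        by (rule t_maximal_prime[OF subdomain_D N'(1) pD q(1)])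
      then show "N' \<in> insert N (Z q)" using only[OF N'(1,2)] N'(1,2) by (auto simp: Z_def)
    qed
    ultimately show "finite (Z g)" by (meson finite_insert finite_subset)
  qed
qed

text \<open>The coefficients of some finite \<open>G \<subseteq> Q\<close> have \<open>v\<close>-hull \<open>R\<close>, so no proper extended \<open>t\<close>-ideal contains \<open>G\<close>. Each of the finitely
  many remaining maximal \<open>t\<close>-ideals containing a fixed nonzero \<open>g \<in> G\<close> is excluded by an element of \<open>Q\<close> outside it.\<close>
lemma isolated_upper_to_zero:
  assumes Q: "Q \<in> t_maximal D" and QR: "Q \<inter> R \<subseteq> {0}"
  shows "isolated D Q"
proof -
  note tQ = t_maximalD(1)[OF Q]
  note QI = t_closed_ideal[OF subdomain_D tQ]
  have "1 \<in> t_hull R (coeffs_of Q)"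
  proof (rule ccontr)
    assume "1 \<notin> t_hull R (coeffs_of Q)"
    then have "Q \<inter> R \<in> t_maximal R" by (rule extended_if_proper_content(1)[OF Q])
    then have "t_closed R (Q \<inter> R)" by (rule t_maximalD(1))
    then show False using QR by (auto simp: t_closed_def)
  qed
  then obtain J j where J: "finite J" "J \<subseteq> coeffs_of Q" "j \<in> J" "j \<noteq> 0" "1 \<in> v_hull R J"
    by (rule t_hullE)
  obtain G where G: "finite G" "G \<subseteq> Q" "J \<subseteq> coeffs_of G"
    using finite_coefficient_witness[OF J(1,2)] .
  obtain g where g: "g \<in> G" "g \<noteq> 0"
    using G(3) J(3,4) unfolding coeffs_of_def by fastforce
  have gD: "g \<in> D" using g G(2) QI(1) by auto
  define Z where "Z = {N \<in> t_maximal D. N \<inter> R \<subseteq> {0} \<and> g \<in> N}"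
  have "finite Z"
    unfolding Z_def
    by (rule finite_uppers_to_zero[OF gD g(2), of "Suc (Max (deg ` supp g))"])
      (use support_finite[OF gD] in \<open>auto simp: less_Suc_eq_le\<close>)
  have "\<exists>h. h \<in> Q \<and> h \<notin> N" if "N \<in> Z - {Q}" for N
    using that t_maximalD(3)[OF Q, of N] t_maximalD(1,2)[of N] by (auto simp: Z_def)
  then obtain h where h: "\<And>N. N \<in> Z - {Q} \<Longrightarrow> h N \<in> Q \<and> h N \<notin> N" by metis
  show ?thesis
  proof (rule isolated_if_finite_subset[OF subdomain_D Q, of "G \<union> h ` (Z - {Q})" g])
    show "finite (G \<union> h ` (Z - {Q}))" using G(1) \<open>finite Z\<close> by simp
    show "G \<union> h ` (Z - {Q}) \<subseteq> Q" using G(2) h by auto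
    show "g \<in> G \<union> h ` (Z - {Q})" using g by simp
    show "g \<noteq> 0" by (rule g(2))
    fix N assume N: "N \<in> t_maximal D" "G \<union> h ` (Z - {Q}) \<subseteq> N"
    have "N \<inter> R \<subseteq> {0}"
    proof (rule ccontr)
      assume "\<not> N \<inter> R \<subseteq> {0}"
      then obtain c where c: "c \<in> N" "c \<in> R" "c \<noteq> 0" by auto
      note N' = t_maximal_extended[OF N(1) c]
      have "J \<subseteq> N \<inter> R"
      proof
        fix x assume "x \<in> J"
        then obtain f t where "f \<in> G" "x = coef f t" using G(3) by (force simp: coeffs_of_def)
        moreover have "f \<in> ext (N \<inter> R)" using \<open>f \<in> G\<close> N(2) N'(2) by blast
        ultimately show "x \<in> N \<inter> R" using extD(2) by blast
      qed
      then have "v_hull R J \<subseteq> N \<inter> R"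
        using t_closed_v_hull[OF t_maximalD(1)[OF N'(1)] J(1) _ J(3,4)] by blast
      then show False using J(5) t_maximalD(2)[OF N'(1)] by blast
    qed
    then have "N \<in> Z" using N g(1) by (auto simp: Z_def)
    then show "N = Q" using h[of N] N(2) by blast
  qed
qed

lemma all_isolated:
  assumes "\<forall>P\<in>t_maximal R. isolated R P"
  shows "\<forall>Q\<in>t_maximal D. isolated D Q"
  using isolated_if_meets_R[OF assms] isolated_upper_to_zero by blast

end

section \<open>Polynomial rings\<close>

abbreviation cf :: "('x, 'a::zero) mpoly \<Rightarrow> ('x \<Rightarrow>\<^sub>0 nat) \<Rightarrow> 'a" where
  "cf p \<equiv> Poly_Mapping.lookup (mapping_of p)"

lemma mpoly_eqI: "(\<And>m. cf p m = cf q m) \<Longrightarrow> p = q"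
  by (metis mapping_of_inject poly_mapping_eqI)

lemma cf_zero [simp]: "cf (0 :: ('x, 'a::comm_ring_1) mpoly) m = 0"
  by (simp add: zero_mpoly.rep_eq)

lemma cf_diff: "cf (p - q) m = cf p m - cf q m"
  by (simp add: minus_mpoly.rep_eq lookup_minus)

lemma cf_add: "cf (p + q) m = cf p m + cf q m"
  by (simp add: plus_mpoly.rep_eq lookup_add)

lemma cf_sum: "cf (\<Sum>i\<in>I. p i) m = (\<Sum>i\<in>I. cf (p i :: ('x, 'a::comm_ring_1) mpoly) m)"
  by (induction I rule: infinite_finite_induct) (auto simp: cf_add)

lemma cf_mult:
  fixes p q :: "('x, 'a::comm_ring_1) mpoly"
  shows "cf (p * q) u =
    (\<Sum>m\<in>Poly_Mapping.keys (mapping_of p). \<Sum>n\<in>Poly_Mapping.keys (mapping_of q).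
      if m + n = u then cf p m * cf q n else 0)"
proof -
  let ?P = "Poly_Mapping.keys (mapping_of p)" and ?Q = "Poly_Mapping.keys (mapping_of q)"
  have "cf (p * q) u = (\<Sum>(m, n). cf p m * cf q n when u = m + n)"
    by (simp add: times_mpoly.rep_eq times_poly_mapping.rep_eq prod_fun_unfold_prod)
  also have "\<dots> = (\<Sum>(m, n)\<in>?P \<times> ?Q. cf p m * cf q n when u = m + n)"
    by (rule Sum_any.expand_superset) (auto simp: in_keys_iff when_def split: if_splits)
  also have "\<dots> = (\<Sum>m\<in>?P. \<Sum>n\<in>?Q. if m + n = u then cf p m * cf q n else 0)"
    by (simp add: sum.cartesian_product when_def eq_commute[of u])
  finally show ?thesis .
qed

lemma mem_poly_ring_iff:
  "p \<in> poly_ring R A \<longleftrightarrow>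
    (\<forall>m. cf p m \<in> R) \<and> (\<forall>m. cf p m \<noteq> 0 \<longrightarrow> Poly_Mapping.keys m \<subseteq> A)"
  by (auto simp: poly_ring_def in_keys_iff)

lemma keys_add_exponents:
  "Poly_Mapping.keys (m + n :: 'x \<Rightarrow>\<^sub>0 nat) = Poly_Mapping.keys m \<union> Poly_Mapping.keys n"
  by (auto simp: in_keys_iff lookup_add)

lemma subdomain_poly_ring:
  fixes R :: "'a::idom set" and A :: "'x set"
  assumes R: "subdomain R"
  shows "subdomain (poly_ring R A)"
  unfolding subdomain_def
proof (intro conjI ballI)
  note R' = subdomain_closed[OF R]
  show "(1 :: ('x, 'a) mpoly) \<in> poly_ring R A"
    using R'(1,2) by (auto simp: mem_poly_ring_iff one_mpoly.rep_eq lookup_one when_def)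
  fix p q :: "('x, 'a) mpoly"
  assume p: "p \<in> poly_ring R A" and q: "q \<in> poly_ring R A"
  show "p - q \<in> poly_ring R A"
    unfolding mem_poly_ring_iff cf_diff
  proof (intro conjI allI impI)
    show "cf p m - cf q m \<in> R" for m using p q R'(3) by (simp add: mem_poly_ring_iff)
    fix m assume "cf p m - cf q m \<noteq> 0"
    then have "cf p m \<noteq> 0 \<or> cf q m \<noteq> 0" by auto
    then show "Poly_Mapping.keys m \<subseteq> A" using p q by (auto simp: mem_poly_ring_iff)
  qed
  show "p * q \<in> poly_ring R A"
    unfolding mem_poly_ring_iff
  proof (intro conjI allI impI)
    show "cf (p * q) u \<in> R" for u
      unfolding cf_mult
      by (intro subdomain_sum[OF R]) (use p q R'(1,4) in \<open>auto simp: mem_poly_ring_iff\<close>)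
    fix u assume "cf (p * q) u \<noteq> 0"
    then have "\<exists>m n. cf p m \<noteq> 0 \<and> cf q n \<noteq> 0 \<and> m + n = u"
    proof (rule contrapos_np)
      assume "\<not> ?thesis"
      then show "cf (p * q) u = 0"
        unfolding cf_mult by (intro sum.neutral ballI) (auto simp: in_keys_iff)
    qed
    then obtain m n where "cf p m \<noteq> 0" "cf q n \<noteq> 0" "u = m + n" by blast
    then show "Poly_Mapping.keys u \<subseteq> A"
      using p q by (simp add: mem_poly_ring_iff keys_add_exponents)
  qed
qed

lemma poly_ring_mono: "F \<subseteq> A \<Longrightarrow> poly_ring R F \<subseteq> poly_ring R A"
  by (auto simp: poly_ring_def)

text \<open>The part of a monomial that involves the indeterminates in \<open>S\<close>.\<close>
definition restr :: "'x set \<Rightarrow> ('x \<Rightarrow>\<^sub>0 nat) \<Rightarrow> ('x \<Rightarrow>\<^sub>0 nat)" where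
  "restr S u = Abs_poly_mapping (\<lambda>x. if x \<in> S then Poly_Mapping.lookup u x else 0)"

lemma lookup_restr:
  "Poly_Mapping.lookup (restr S u) x = (if x \<in> S then Poly_Mapping.lookup u x else 0)"
proof -
  have "finite {x. (if x \<in> S then Poly_Mapping.lookup u x else 0) \<noteq> 0}"
    by (rule finite_subset[OF _ finite_keys[of u]]) (auto simp: in_keys_iff)
  then show ?thesis by (simp add: restr_def)
qed

lemma keys_restr: "Poly_Mapping.keys (restr S u) = Poly_Mapping.keys u \<inter> S"
  by (auto simp: in_keys_iff lookup_restr split: if_splits)

lemma restr_split: "restr F u + restr (- F) u = u"
  by (rule poly_mapping_eqI) (simp add: lookup_add lookup_restr)

lemma split_unique:
  assumes "Poly_Mapping.keys m \<subseteq> F" "Poly_Mapping.keys t \<inter> F = {}"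
  shows "m + t = u \<longleftrightarrow> m = restr F u \<and> t = restr (- F) u"
proof
  assume u: "m + t = u"
  have m: "Poly_Mapping.lookup m x = 0" if "x \<notin> F" for x
    using assms(1) that by (meson in_keys_iff subsetD)
  have t: "Poly_Mapping.lookup t x = 0" if "x \<in> F" for x
    using assms(2) that by (meson disjoint_iff in_keys_iff)
  show "m = restr F u \<and> t = restr (- F) u"
    unfolding u[symmetric]
    by (auto intro!: poly_mapping_eqI simp: lookup_restr lookup_add m t)
qed (simp add: restr_split)

definition monom_at :: "('x \<Rightarrow>\<^sub>0 nat) \<Rightarrow> ('x, 'a::comm_ring_1) mpoly" where
  "monom_at t = MPoly (Poly_Mapping.single t 1)"

text \<open>The coefficient of the monomial \<open>t\<close>, which involves no indeterminate from \<open>F\<close>, when \<open>p\<close> is read as a polynomial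
  over the ring of polynomials in the indeterminates from \<open>F\<close>.\<close>
definition coeff_over :: "'x set \<Rightarrow> ('x, 'a::comm_ring_1) mpoly \<Rightarrow> ('x \<Rightarrow>\<^sub>0 nat) \<Rightarrow> ('x, 'a) mpoly" where
  "coeff_over F p t = MPoly (Abs_poly_mapping (\<lambda>m.
     if Poly_Mapping.keys m \<subseteq> F \<and> Poly_Mapping.keys t \<inter> F = {} then cf p (m + t) else 0))"

lemma cf_monom_at: "cf (monom_at t) m = (if m = t then 1 else 0)"
  by (simp add: monom_at_def MPoly_inverse lookup_single when_def eq_commute)

lemma cf_coeff_over:
  "cf (coeff_over F p t) m =
    (if Poly_Mapping.keys m \<subseteq> F \<and> Poly_Mapping.keys t \<inter> F = {} then cf p (m + t) else 0)"
proof -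
  have "inj_on (\<lambda>m. m + t) UNIV" by (auto simp: inj_on_def)
  then have "finite ((\<lambda>m. m + t) -` Poly_Mapping.keys (mapping_of p))"
    by (intro finite_vimageI) auto
  then have "finite {m. (if Poly_Mapping.keys m \<subseteq> F \<and> Poly_Mapping.keys t \<inter> F = {}
      then cf p (m + t) else 0) \<noteq> 0}"
    by (rule rev_finite_subset) (auto simp: in_keys_iff)
  then show ?thesis by (simp add: coeff_over_def MPoly_inverse)
qed

text \<open>The factor \<open>q\<close> involves only the indeterminates in \<open>F\<close>, the monomial only those outside, so each monomial of the
  product arises once.\<close>
lemma cf_mult_monom_at:
  fixes q :: "('x, 'a::comm_ring_1) mpoly"
  assumes q: "\<And>m. cf q m \<noteq> 0 \<Longrightarrow> Poly_Mapping.keys m \<subseteq> F" and t: "Poly_Mapping.keys t \<inter> F = {}"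
  shows "cf (q * monom_at t) u = (if restr (- F) u = t then cf q (restr F u) else 0)"
proof -
  let ?K = "Poly_Mapping.keys (mapping_of q)"
  have k: "Poly_Mapping.keys (mapping_of (monom_at t :: ('x, 'a) mpoly)) = {t}"
    by (auto simp: in_keys_iff cf_monom_at split: if_splits)
  have "cf (q * monom_at t) u = (\<Sum>m\<in>?K. if m + t = u then cf q m else 0)"
    unfolding cf_mult k by (simp add: cf_monom_at cong: if_cong)
  also have "\<dots> = (\<Sum>m\<in>?K. if m = restr F u then (if restr (- F) u = t then cf q m else 0) else 0)"
    by (rule sum.cong[OF refl]) (use split_unique[OF q t] in \<open>auto simp: in_keys_iff\<close>)
  also have "\<dots> = (if restr (- F) u = t then cf q (restr F u) else 0)"
    by (simp add: sum.delta in_keys_iff)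
  finally show ?thesis .
qed

lemma monomial_basis_poly_ring:
  fixes R :: "'a::idom set" and A :: "'x set"
  assumes R: "subdomain R" and FA: "F \<subseteq> A"
  shows "monomial_basis (poly_ring R F) (poly_ring R A) {t. Poly_Mapping.keys t \<subseteq> A - F}
    monom_at (coeff_over F)"
proof
  note R' = subdomain_closed[OF R]
  let ?T = "{t. Poly_Mapping.keys t \<subseteq> A - F} :: ('x \<Rightarrow>\<^sub>0 nat) set"
  show "subdomain (poly_ring R F :: ('x, 'a) mpoly set)" "subdomain (poly_ring R A :: ('x, 'a) mpoly set)"
    by (rule subdomain_poly_ring[OF R])+
  show "poly_ring R F \<subseteq> (poly_ring R A :: ('x, 'a) mpoly set)" by (rule poly_ring_mono[OF FA])
  show "0 \<in> ?T" by simp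
  show "s + t \<in> ?T" if "s \<in> ?T" "t \<in> ?T" for s t
    using that by (simp add: keys_add_exponents)
  show "(monom_at 0 :: ('x, 'a) mpoly) = 1"
    by (rule mpoly_eqI) (simp add: cf_monom_at one_mpoly.rep_eq lookup_one when_def)
  show "(monom_at (s + t) :: ('x, 'a) mpoly) = monom_at s * monom_at t" for s t
    by (rule mpoly_eqI)
      (simp add: monom_at_def times_mpoly.rep_eq MPoly_inverse mult_single)
  show "(monom_at t :: ('x, 'a) mpoly) \<in> poly_ring R A" if "t \<in> ?T" for t
    using that R'(1,2) by (auto simp: mem_poly_ring_iff cf_monom_at split: if_splits)
  fix f :: "('x, 'a) mpoly" assume f: "f \<in> poly_ring R A"
  have nz: "restr (- F) (m + t) = t \<and> cf f (m + t) \<noteq> 0 \<and> Poly_Mapping.keys t \<inter> F = {}"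
    if "cf (coeff_over F f t) m \<noteq> 0" for m t
    using that split_unique[of m F t "m + t"] by (auto simp: cf_coeff_over split: if_splits)
  have ex: "\<exists>m. cf (coeff_over F f t) m \<noteq> 0" if "coeff_over F f t \<noteq> 0" for t
    using that mpoly_eqI[of "coeff_over F f t" 0] by auto
  show "coeff_over F f t \<in> poly_ring R F" for t
    using f R'(1) by (auto simp: mem_poly_ring_iff cf_coeff_over)
  show fin: "finite {t. coeff_over F f t \<noteq> 0}"
  proof (rule finite_subset)
    show "{t. coeff_over F f t \<noteq> 0} \<subseteq> restr (- F) ` Poly_Mapping.keys (mapping_of f)"
    proof
      fix t assume "t \<in> {t. coeff_over F f t \<noteq> 0}"
      then obtain m where "cf (coeff_over F f t) m \<noteq> 0" using ex by blast
      from nz[OF this] have "t = restr (- F) (m + t)" "m + t \<in> Poly_Mapping.keys (mapping_of f)"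
        by (simp_all add: in_keys_iff)
      then show "t \<in> restr (- F) ` Poly_Mapping.keys (mapping_of f)" by (rule image_eqI)
    qed
  qed simp
  show "t \<in> ?T" if t: "coeff_over F f t \<noteq> 0" for t
  proof -
    obtain m where "cf (coeff_over F f t) m \<noteq> 0" using ex[OF t] by blast
    from nz[OF this] have "cf f (m + t) \<noteq> 0" "Poly_Mapping.keys t \<inter> F = {}" by auto
    then have "Poly_Mapping.keys (m + t) \<subseteq> A" using f unfolding mem_poly_ring_iff by blast
    then show ?thesis using \<open>Poly_Mapping.keys t \<inter> F = {}\<close> by (auto simp: keys_add_exponents)
  qed
  show "f = (\<Sum>t\<in>{t. coeff_over F f t \<noteq> 0}. coeff_over F f t * monom_at t)"
  proof (rule mpoly_eqI)
    fix u
    let ?S = "{t. coeff_over F f t \<noteq> 0}"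
    let ?t = "restr (- F) u"
    have disj: "Poly_Mapping.keys t \<inter> F = {}" if "t \<in> ?S" for t
      using ex[of t] nz[of t] that by blast
    have "cf (\<Sum>t\<in>?S. coeff_over F f t * monom_at t) u =
        (\<Sum>t\<in>?S. cf (coeff_over F f t * monom_at t) u)"
      by (rule cf_sum)
    also have "\<dots> = (\<Sum>t\<in>?S. if t = ?t then cf (coeff_over F f ?t) (restr F u) else 0)"
    proof (rule sum.cong[OF refl])
      fix t assume "t \<in> ?S"
      have "cf (coeff_over F f t * monom_at t) u =
          (if ?t = t then cf (coeff_over F f t) (restr F u) else 0)"
        by (rule cf_mult_monom_at[OF _ disj[OF \<open>t \<in> ?S\<close>]])
          (auto simp: cf_coeff_over split: if_splits)
      then show "cf (coeff_over F f t * monom_at t) u =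
          (if t = ?t then cf (coeff_over F f ?t) (restr F u) else 0)"
        by auto
    qed
    also have "\<dots> = cf (coeff_over F f ?t) (restr F u)"
      using fin by (auto simp: sum.delta)
    also have "\<dots> = cf f u"
      by (auto simp: cf_coeff_over keys_restr restr_split)
    finally show "cf f u = cf (\<Sum>t\<in>?S. coeff_over F f t * monom_at t) u" by simp
  qed
next
  fix f g :: "('x, 'a) mpoly" and t
  show "coeff_over F (f - g) t = coeff_over F f t - coeff_over F g t"
    by (rule mpoly_eqI) (simp add: cf_diff cf_coeff_over)
next
  fix r :: "('x, 'a) mpoly" and s t :: "'x \<Rightarrow>\<^sub>0 nat"
  assume r: "r \<in> poly_ring R F" and s: "s \<in> {t. Poly_Mapping.keys t \<subseteq> A - F}"
  have rF: "Poly_Mapping.keys m \<subseteq> F" if "cf r m \<noteq> 0" for m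
    using r that by (auto simp: mem_poly_ring_iff)
  have sF: "Poly_Mapping.keys s \<inter> F = {}" using s by auto
  show "coeff_over F (r * monom_at s) t = (if t = s then r else 0)"
  proof (rule mpoly_eqI)
    fix m
    show "cf (coeff_over F (r * monom_at s) t) m = cf (if t = s then r else 0) m"
    proof (cases "Poly_Mapping.keys m \<subseteq> F \<and> Poly_Mapping.keys t \<inter> F = {}")
      case True
      then have e: "restr F (m + t) = m" "restr (- F) (m + t) = t"
        using split_unique[of m F t "m + t"] by simp_all
      have "cf (coeff_over F (r * monom_at s) t) m = cf (r * monom_at s) (m + t)"
        using True by (simp add: cf_coeff_over)
      also have "\<dots> = (if t = s then cf r m else 0)"
        using cf_mult_monom_at[of r F s "m + t", OF rF sF] unfolding e .
      finally show ?thesis by simp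
    next
      case False
      then have "cf (if t = s then r else 0) m = 0"
        using rF[of m] sF by (cases "t = s") auto
      then show ?thesis unfolding cf_coeff_over if_not_P[OF False] by simp
    qed
  qed
next
  fix M N :: "('x \<Rightarrow>\<^sub>0 nat) set"
  assume *: "finite M" "finite N" "M \<noteq> {}" "N \<noteq> {}"
  define V where "V = (\<Union>m\<in>M \<union> N. Poly_Mapping.keys m)"
  have V: "Poly_Mapping.lookup m x = 0" if "m \<in> M \<union> N" "x \<notin> V" for m x
    using that by (auto simp: V_def in_keys_iff)
  show "\<exists>m\<in>M. \<exists>n\<in>N. \<forall>m'\<in>M. \<forall>n'\<in>N. m' + n' = m + n \<longrightarrow> m' = m \<and> n' = n"
  proof (rule ex_unique_sum_of_monomials[of V])
    show "finite V" using * by (simp add: V_def)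
    show "Poly_Mapping.lookup m x = Poly_Mapping.lookup m' x"
      if "m \<in> M" "m' \<in> M" "x \<notin> V" for m m' x
      using V[of m x] V[of m' x] that by simp
    show "Poly_Mapping.lookup n x = Poly_Mapping.lookup n' x"
      if "n \<in> N" "n' \<in> N" "x \<notin> V" for n n' x
      using V[of n x] V[of n' x] that by simp
  qed (rule *)+
qed

lemma univariate_basis_poly_ring:
  fixes R :: "'a::idom set" and F :: "'x set"
  assumes R: "subdomain R" and x: "x \<notin> F"
  shows "univariate_basis (poly_ring R F) (poly_ring R (insert x F))
    {t. Poly_Mapping.keys t \<subseteq> {x}} monom_at (coeff_over F) (\<lambda>t. Poly_Mapping.lookup t x)"
proof -
  have diff: "insert x F - F = {x}" using x by auto
  have single: "Poly_Mapping.single x (Poly_Mapping.lookup t x) = t"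
    if "Poly_Mapping.keys t \<subseteq> {x}" for t :: "'x \<Rightarrow>\<^sub>0 nat"
    by (rule poly_mapping_eqI) (use that in \<open>auto simp: lookup_single when_def in_keys_iff\<close>)
  show ?thesis
  proof (intro univariate_basis.intro univariate_basis_axioms.intro)
    show "monomial_basis (poly_ring R F) (poly_ring R (insert x F))
        {t. Poly_Mapping.keys t \<subseteq> {x}} monom_at (coeff_over F)"
      using monomial_basis_poly_ring[OF R subset_insertI[of F x]] unfolding diff .
    show "inj_on (\<lambda>t. Poly_Mapping.lookup t x :: nat) {t. Poly_Mapping.keys t \<subseteq> {x}}"
      by (rule inj_on_inverseI[of _ "Poly_Mapping.single x"]) (simp add: single)
    show "Poly_Mapping.lookup (s + t) x = Poly_Mapping.lookup s x + Poly_Mapping.lookup t x"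
      for s t :: "'x \<Rightarrow>\<^sub>0 nat"
      by (rule lookup_add)
    fix s t :: "'x \<Rightarrow>\<^sub>0 nat"
    assume st: "s \<in> {t. Poly_Mapping.keys t \<subseteq> {x}}" "t \<in> {t. Poly_Mapping.keys t \<subseteq> {x}}"
      "Poly_Mapping.lookup s x \<le> Poly_Mapping.lookup t x"
    let ?u = "Poly_Mapping.single x (Poly_Mapping.lookup t x - Poly_Mapping.lookup s x)"
    have "s + ?u = Poly_Mapping.single x (Poly_Mapping.lookup s x) + ?u"
      using single[of s] st(1) by (simp only: mem_Collect_eq)
    also have "\<dots> = Poly_Mapping.single x (Poly_Mapping.lookup t x)"
      using st(3) by (simp flip: single_add)
    also have "\<dots> = t" using single[of t] st(2) by (simp only: mem_Collect_eq)
    finally have "t = s + ?u" by (rule sym)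
    then show "\<exists>u\<in>{t. Poly_Mapping.keys t \<subseteq> {x}}. t = s + u"
      by (intro bexI[of _ ?u]) auto
  qed
qed

lemma poly_ring_empty:
  fixes R :: "'a::idom set"
  assumes "0 \<in> R"
  shows "(poly_ring R {} :: ('x, 'a) mpoly set) = (\<lambda>r. MPoly (Poly_Mapping.single 0 r)) ` R"
proof (rule set_eqI, rule iffI)
  fix p :: "('x, 'a) mpoly" assume p: "p \<in> poly_ring R {}"
  have "p = MPoly (Poly_Mapping.single 0 (cf p 0))"
    by (rule mpoly_eqI) (use p in \<open>auto simp: mem_poly_ring_iff MPoly_inverse lookup_single when_def\<close>)
  then show "p \<in> (\<lambda>r. MPoly (Poly_Mapping.single 0 r)) ` R"
    using p by (auto simp: mem_poly_ring_iff)
qed (use assms in \<open>auto simp: mem_poly_ring_iff MPoly_inverse lookup_single when_def split: if_splits\<close>)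

lemma injective_ring_hom_const:
  "injective_ring_hom (\<lambda>r :: 'a::idom. MPoly (Poly_Mapping.single 0 r) :: ('x, 'a) mpoly)"
proof
  show "inj (\<lambda>r :: 'a. MPoly (Poly_Mapping.single 0 r) :: ('x, 'a) mpoly)"
    by (rule injI) (metis MPoly_inverse UNIV_I lookup_single_eq)
  show "(MPoly (Poly_Mapping.single 0 1) :: ('x, 'a) mpoly) = 1"
    by (rule mpoly_eqI) (simp add: MPoly_inverse one_mpoly.rep_eq)
  fix x y :: 'a
  show "(MPoly (Poly_Mapping.single 0 (x - y)) :: ('x, 'a) mpoly) =
      MPoly (Poly_Mapping.single 0 x) - MPoly (Poly_Mapping.single 0 y)"
    by (rule mpoly_eqI) (simp add: MPoly_inverse minus_mpoly.rep_eq single_diff)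
  show "(MPoly (Poly_Mapping.single 0 (x * y)) :: ('x, 'a) mpoly) =
      MPoly (Poly_Mapping.single 0 x) * MPoly (Poly_Mapping.single 0 y)"
    by (rule mpoly_eqI) (simp add: MPoly_inverse times_mpoly.rep_eq mult_single)
qed

lemma all_isolated_finite:
  fixes R :: "'a::idom set" and F :: "'x set"
  assumes R: "subdomain R" and iso: "\<forall>P\<in>t_maximal R. isolated R P" and "finite F"
  shows "\<forall>Q\<in>t_maximal (poly_ring R F). isolated (poly_ring R F) Q"
  using \<open>finite F\<close>
proof (induction F rule: finite_induct)
  case empty
  interpret injective_ring_hom "\<lambda>r. MPoly (Poly_Mapping.single 0 r) :: ('x, 'a) mpoly"
    by (rule injective_ring_hom_const)
  show ?case
    unfolding poly_ring_empty[OF subdomain_closed(1)[OF R]] using all_isolated_image[of R] iso by blast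
next
  case (insert x F)
  interpret univariate_basis "poly_ring R F" "poly_ring R (insert x F)"
    "{t. Poly_Mapping.keys t \<subseteq> {x}}" monom_at "coeff_over F" "\<lambda>t. Poly_Mapping.lookup t x"
    by (rule univariate_basis_poly_ring[OF R insert.hyps(2)])
  show ?case by (rule all_isolated[OF insert.IH])
qed

theorem theorem3p4:
  fixes R :: "'a::idom set" and A :: "'x set"
  assumes "subdomain R"
    and "t_sharp_domain R"
  shows "t_sharp_domain (poly_ring R A)"
  unfolding t_sharp_domain_iff_isolated
proof (intro conjI ballI)
  show "subdomain (poly_ring R A)" by (rule subdomain_poly_ring[OF assms(1)])
  have iso: "\<forall>P\<in>t_maximal R. isolated R P"
    using assms(2) unfolding t_sharp_domain_iff_isolated by blast
  fix Q :: "('x, 'a) mpoly set" assume Q: "Q \<in> t_maximal (poly_ring R A)"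
  then obtain f where f: "f \<in> Q" "f \<noteq> 0" "f \<in> poly_ring R A"
    using t_maximalD(1)[OF Q] by (auto simp: t_closed_def)
  \<comment> \<open>With the indeterminates of \<open>f\<close> adjoined, the base ring meets \<open>Q\<close> in a nonzero ideal.\<close>
  define F where "F = (\<Union>m\<in>Poly_Mapping.keys (mapping_of f). Poly_Mapping.keys m)"
  have "finite F" by (simp add: F_def)
  have "F \<subseteq> A" using f(3) by (auto simp: F_def poly_ring_def)
  have fF: "f \<in> poly_ring R F" using f(3) by (auto simp: F_def poly_ring_def)
  interpret monomial_basis "poly_ring R F" "poly_ring R A"
    "{t. Poly_Mapping.keys t \<subseteq> A - F}" monom_at "coeff_over F"
    by (rule monomial_basis_poly_ring[OF assms(1) \<open>F \<subseteq> A\<close>])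
  show "isolated (poly_ring R A) Q"
    by (rule isolated_if_meets_R[OF all_isolated_finite[OF assms(1) iso \<open>finite F\<close>] Q f(1) fF f(2)])
qed

end
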